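(* Let $a>0$ and let $n\ge1$ be a fixed odd integer. There are constants $C,\Lambda>0$ depending only on $a$ and $n$ such that for every $\lambda\ge\Lambda$ with $1\le n<n_\lambda$ there are a non-zero complex number $c$ (independent of $t$ and $x$) and a function $r:(0,\infty)\to\mathbb C$ with $$\Psi_n(\cdot,t)=c\,\chi_aG_n\,e^{-i\frac{z_n^2}{2}t}+\chi_aG_n\,r(t)\qquad\text{for all }t>0,$$ where $|c|\le C$ and $|r(t)|\le C\lambda^{-2}\,t^{-1/2}$ for all $t>0$.
   Context: Fix $a>0$, write $\chi_a=\chi_{[-a,a]}$; for $\lambda>0$ let $V_\lambda=\lambda\chi_a$ and $H_\lambda=-\frac12\frac{d^2}{dx^2}+V_\lambda$ on $L^2(\mathbb R)$. Square roots and logarithms are principal branches. For $k$ write $\tilde k=\sqrt{k^2-2\lambda}$ and $F(k)=\cos\tilde ka-i\frac{\tilde k}{k}\sin\tilde ka$ (even in $\tilde k$, hence meromorphic in $k$); for $k>0$ let $\bar F(k)=\cos\tilde ka+i\frac{\tilde k}{k}\sin\tilde ka$. Symmetric generalized eigenfunctions of $H_\lambda$: for $|x|\le a$, $\phi(k,x)=\frac{e^{-ika}}{\sqrt\pi\,F(k)}\cos(\tilde kx)$, and for $|x|>a$, $\phi(k,x)=\frac{e^{-ika}}{\sqrt{4\pi}}\left(e^{-ik(|x|-a)}+\frac{\bar F(k)}{F(k)}e^{ik(|x|-a)}\right)$. Resonances: for an integer $n\ge1$, $z_n$ is the complex number with $\operatorname{Re}z_n>0$, $\operatorname{Im}z_n<0$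 such that, with $\tilde z_n=\sqrt{z_n^2-2\lambda}$, the number $\tilde\kappa=\tilde z_n/\sqrt{2\lambda}$ satisfies $\tilde\kappa=\frac{n\pi}{2a\sqrt{2\lambda}}-\frac{i}{a\sqrt{2\lambda}}\ln(\tilde\kappa+\sqrt{\tilde\kappa^2+1})$. For odd $n$, $F$ has a simple zero at $z_n$. For odd $n$ the Gamow function satisfies $G_n(x)=\cos(\tilde z_nx)$ for $|x|\le a$. For odd $n$: - $\psi_n(x)=\cos\!\left(\frac{n\pi x}{2a}\right)\chi_a(x)$ (symmetric bound state of $-\frac12\frac{d^2}{dx^2}+\lambda$ on $[-a,a]$ with Dirichlet conditions at $\pm a$); - $\hat\psi_n(k)=\int_{\mathbb R}\psi_n(x)\overline{\phi(k,x)}\,dx$ for $k>0$; - $\eta_n(k)=e^{-ika}\frac{a_{-1}}{k-z_n}$ with $a_{-1}=\operatorname{Res}_{k=z_n}\frac{1}{\sqrt\pi F(k)}$; - $\Psi_n(x,t)=\chi_a(x)G_n(x)\int_0^\infty\hat\psi_n(k)\,\eta_n(k)\,e^{-i\frac{k^2}{2}t}\,dk$. Finally $n_\lambda=\sqrt{\lambda/2-\sqrt{2\lambda}}$. *)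

theory Defs
  imports "HOL-Complex_Analysis.Complex_Analysis"
begin

definition chi :: "real \<Rightarrow> real \<Rightarrow> complex" where
  "chi a x = indicator {-a..a} x"

definition ktilde :: "real \<Rightarrow> complex \<Rightarrow> complex" where
  "ktilde lam k = csqrt (k\<^sup>2 - 2 * of_real lam)"

text \<open>Even in \<open>ktilde lam k\<close>, so the branch cut of \<open>csqrt\<close> is invisible in \<open>F\<close>,
  which is meromorphic in \<open>k\<close>.\<close>

definition F :: "real \<Rightarrow> real \<Rightarrow> complex \<Rightarrow> complex" where
  "F a lam k =
     cos (ktilde lam k * of_real a) - \<i> * (ktilde lam k / k) * sin (ktilde lam k * of_real a)"

definition Fbar :: "real \<Rightarrow> real \<Rightarrow> real \<Rightarrow> complex" where
  "Fbar a lam k =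
     cos (ktilde lam (of_real k) * of_real a)
       + \<i> * (ktilde lam (of_real k) / of_real k) * sin (ktilde lam (of_real k) * of_real a)"

text \<open>Symmetric generalized eigenfunctions of \<open>-1/2 d\<^sup>2/dx\<^sup>2 + lam * chi a\<close>, for \<open>k > 0\<close>.\<close>

definition phi :: "real \<Rightarrow> real \<Rightarrow> real \<Rightarrow> real \<Rightarrow> complex" where
  "phi a lam k x =
     (if \<bar>x\<bar> \<le> a
      then exp (- \<i> * of_real k * of_real a) / (of_real (sqrt pi) * F a lam (of_real k))
             * cos (ktilde lam (of_real k) * of_real x)
      else exp (- \<i> * of_real k * of_real a) / of_real (sqrt (4 * pi))
             * (exp (- \<i> * of_real k * of_real (\<bar>x\<bar> - a))
                + Fbar a lam k / F a lam (of_real k) * exp (\<i> * of_real k * of_real (\<bar>x\<bar> - a))))"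

text \<open>\<open>\<kappa>\<close> stands for \<open>ktilde lam z / sqrt (2 * lam)\<close>; see \<open>zres\<close>.\<close>

definition resonance_eq :: "real \<Rightarrow> real \<Rightarrow> nat \<Rightarrow> complex \<Rightarrow> bool" where
  "resonance_eq a lam n \<kappa> \<longleftrightarrow>
     \<kappa> = of_real (real n * pi / (2 * a * sqrt (2 * lam)))
          - \<i> / of_real (a * sqrt (2 * lam)) * Ln (\<kappa> + csqrt (\<kappa>\<^sup>2 + 1))"

text \<open>A number \<open>z\<close> as described exists and is unique, for \<open>n \<ge> 1\<close>, once \<open>a * sqrt (2 * lam)\<close> is large.\<close>

definition zres :: "real \<Rightarrow> real \<Rightarrow> nat \<Rightarrow> complex" where
  "zres a lam n =
     (THE z. Re z > 0 \<and> Im z < 0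
           \<and> resonance_eq a lam n (ktilde lam z / of_real (sqrt (2 * lam))))"

text \<open>The functions below are the symmetric ones, meant for odd \<open>n\<close>. Outside
  \<open>{-a..a}\<close> the Gamow function is continued by the outgoing wave; this is \<open>C\<^sup>1\<close> because
  \<open>F\<close> vanishes at \<open>zres a lam n\<close>. Only its values on \<open>{-a..a}\<close> enter \<open>Psi\<close>.\<close>

definition gamow :: "real \<Rightarrow> real \<Rightarrow> nat \<Rightarrow> real \<Rightarrow> complex" where
  "gamow a lam n x =
     (if \<bar>x\<bar> \<le> a
      then cos (ktilde lam (zres a lam n) * of_real x)
      else cos (ktilde lam (zres a lam n) * of_real a)
             * exp (\<i> * zres a lam n * of_real (\<bar>x\<bar> - a)))"

definition psi :: "real \<Rightarrow> nat \<Rightarrow> real \<Rightarrow> complex" where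
  "psi a n x = of_real (cos (real n * pi * x / (2 * a))) * chi a x"

definition psi_hat :: "real \<Rightarrow> real \<Rightarrow> nat \<Rightarrow> real \<Rightarrow> complex" where
  "psi_hat a lam n k = (LINT x|lborel. psi a n x * cnj (phi a lam k x))"

definition eta :: "real \<Rightarrow> real \<Rightarrow> nat \<Rightarrow> real \<Rightarrow> complex" where
  "eta a lam n k =
     exp (- \<i> * of_real k * of_real a)
       * (residue (\<lambda>w. 1 / (of_real (sqrt pi) * F a lam w)) (zres a lam n)
          / (of_real k - zres a lam n))"

definition Psi :: "real \<Rightarrow> real \<Rightarrow> nat \<Rightarrow> real \<Rightarrow> real \<Rightarrow> complex" where
  "Psi a lam n x t =
     chi a x * gamow a lam n x
       * (LINT k:{0<..}|lborel.
            psi_hat a lam n k * eta a lam n k * exp (- \<i> * of_real (k\<^sup>2 / 2) * of_real t))"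

definition n_lam :: "real \<Rightarrow> real" where
  "n_lam lam = sqrt (lam / 2 - sqrt (2 * lam))"

end

theory Submission
  imports Defs
begin

text \<open>Put \<open>b = n \<pi> / (2 a)\<close>. For \<open>k > 0\<close> the product \<open>psi_hat * eta\<close> equals \<open>A h(k) / (k - z)\<close> with
  \<open>h(k) = cos (ktilde a) / ((b\<^sup>2 - ktilde\<^sup>2) Fbar(k))\<close>, and \<open>h\<close> extends to the closed sector between the
  positive real axis and the ray of argument \<open>- \<pi> / 4\<close>. There
  \<open>Re (k Fbar(k) cnj (cos (ktilde a))) \<ge> Re k \<bar>cos (ktilde a)\<bar>\<^sup>2\<close> excludes zeros of \<open>Fbar\<close> and gives
  \<open>\<bar>h(k)\<bar> \<le> 2 / \<bar>b\<^sup>2 + 2 lam - k\<^sup>2\<bar>\<close>. Rotating the integral to the ray crosses only the pole at the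
  resonance \<open>z\<close>, which produces the exponential term. On the ray the oscillating factor is a real Gaussian,
  \<open>\<bar>h\<bar> \<le> 1 / lam\<close>, \<open>\<bar>k - z\<bar>\<close> is at least of order \<open>sqrt lam\<close> and \<open>\<bar>A\<bar>\<close> at most of order \<open>1 / sqrt lam\<close>,
  which together bound the remainder by a multiple of \<open>lam powr (-2) * t powr (-1/2)\<close>. The resonance itself is
  the fixed point of a contraction.\<close>

subsection \<open>Rotating the half-line to the diagonal\<close>

lemma set_integrable_atLeast_inverse_square:
  fixes f :: "real \<Rightarrow> complex"
  assumes cont: "continuous_on {0..} f" and X: "0 < X"
    and decay: "\<And>x. X \<le> x \<Longrightarrow> norm (f x) \<le> D / x^2"
  shows "set_integrable lborel {0..} f"
proof -
  have "set_integrable lborel {0..X} f"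
    by (intro borel_integrable_atLeastAtMost' continuous_on_subset[OF cont]) auto
  moreover have "set_integrable lborel {X..} f"
  proof (rule set_integrable_bound)
    have "(\<lambda>x::real. 1 / x^2) integrable_on {X..}"
      using has_integral_inverse_power_to_inf[of 2 X] X by (auto simp: has_integral_iff)
    then have "(\<lambda>x::real. 1 / x^2) absolutely_integrable_on {X..}"
      by (intro nonnegative_absolutely_integrable_1) auto
    then have "set_integrable lborel {X..} (\<lambda>x::real. 1 / x^2)"
      unfolding set_integrable_def by (subst (asm) integrable_completion) auto
    then show "set_integrable lborel {X..} (\<lambda>x. D * (1 / x^2))"
      by (rule set_integrable_mult_right)
    show "set_borel_measurable lborel {X..} f"
      unfolding set_borel_measurable_def using X
      by (simp, intro borel_measurable_continuous_on_indicator continuous_on_subset[OF cont]) auto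
    show "AE x in lborel. x \<in> {X..} \<longrightarrow> norm (f x) \<le> norm (D * (1 / x^2))"
    proof (intro AE_I2 impI)
      fix x assume "x \<in> {X..}"
      then have "norm (f x) \<le> D / x^2" by (intro decay) auto
      also have "\<dots> \<le> norm (D * (1 / x^2))" using abs_ge_self[of "D / x^2"] by simp
      finally show "norm (f x) \<le> norm (D * (1 / x^2))" .
    qed
  qed
  ultimately have "set_integrable lborel ({0..X} \<union> {X..}) f"
    by (intro set_integrable_Un) auto
  moreover have "{0..X} \<union> {X..} = {0..}" using X by auto
  ultimately show ?thesis by simp
qed

text \<open>The closed sector of arguments from \<open>- pi / 4\<close> to 0. It lies below the real
  axis because the real part of \<open>- i w^2 t / 2\<close> is \<open>t * Re w * Im w\<close>,
  which must be nonpositive for \<open>t > 0\<close>.\<close>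

definition wedge :: "complex set" where
  "wedge = {w. 0 \<le> - Im w \<and> - Im w \<le> Re w}"

lemma triangle_subset_wedge:
  assumes "0 < R" "w \<in> convex hull {0, of_real R, Complex R (- R)}"
  shows "w \<in> wedge"
proof -
  obtain x y v where "0 \<le> x" "0 \<le> y" "0 \<le> v" "x + y + v = 1"
     "w = x *\<^sub>R 0 + y *\<^sub>R of_real R + v *\<^sub>R Complex R (- R)"
    using assms(2) unfolding convex_hull_3 by blast
  then show ?thesis using assms(1) by (simp add: wedge_def)
qed

text \<open>Linear inequalities for the interior let the position of the pole be read off from its
  real and imaginary parts. They are barycentric coordinates in disguise; the triangle is
  nondegenerate because the quotient of its two nonzero vertices is not real.\<close>

lemma interior_triangle:
  assumes "0 < R"
  shows "interior (convex hull {0, of_real R, Complex R (- R)}) = {w. 0 < - Im w \<and> - Im w < Re w \<and> Re w < R}"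
    (is "interior ?T = ?I")
proof -
  have "Complex R (-R) / of_real R = Complex 1 (-1)"
    using assms by (simp add: complex_eq_iff)
  then have "\<not> collinear {0, of_real R, Complex R (- R)}"
    unfolding collinear_iff_Reals by (simp add: complex_is_Real_iff)
  then have *: "interior ?T = {w. \<exists>x y v. 0 < x \<and> 0 < y \<and> 0 < v \<and> x + y + v = 1 \<and>
      x *\<^sub>R 0 + y *\<^sub>R of_real R + v *\<^sub>R Complex R (- R) = w}"
    by (intro interior_convex_hull_3_minimal) auto
  show ?thesis unfolding *
  proof (intro set_eqI iffI; clarsimp)
    fix x y v :: real assume "0 < x" "0 < y" "0 < v" "x + y + v = 1"
    then show "0 < v * R \<and> 0 < y * R \<and> y * R + v * R < R"
      using assms mult_strict_right_mono[of "y + v" 1 R] by (simp add: algebra_simps)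
  next
    fix w :: complex assume w: "Im w < 0" "- Im w < Re w" "Re w < R"
    \<comment> \<open>The witnesses are the barycentric coordinates of \<open>w\<close>; the first
      weight belongs to the vertex 0 and vanishes on the vertical side.\<close>
    show "\<exists>x>0. \<exists>y>0. \<exists>v>0. x + y + v = 1 \<and> y *\<^sub>R complex_of_real R + v *\<^sub>R Complex R (- R) = w"
      using assms w
      by (intro exI[of _ "1 - Re w / R"] exI[of _ "(Re w + Im w) / R"] exI[of _ "- Im w / R"] conjI)
         (auto simp: field_simps complex_eq_iff)
  qed
qed

section \<open>Estimates along the sides of the triangle\<close>

lemma norm_exp_quadratic_le:
  assumes "w \<in> wedge" "t > 0"
  shows "norm (exp (- \<i> * (w\<^sup>2 / 2) * of_real t)) \<le> 1"
proof -
  have "Re w * Im w * t \<le> 0"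
    using assms by (auto simp: wedge_def mult_nonneg_nonpos mult_nonpos_nonneg)
  then show ?thesis
    by (simp add: norm_exp_eq_Re Im_power2)
qed

text \<open>Majorant for the Gaussian on the diagonal: \<open>exp (- y) \<le> 1 / (1 + y)\<close>
  leads to an integrand with an elementary antiderivative. Since \<open>arctan\<close> stays below
  \<open>pi / 2\<close>, the bound is uniform in \<open>R\<close> and of order
  \<open>1 / sqrt t\<close>.\<close>

lemma has_integral_lorentzian:
  fixes R t :: real
  assumes "0 < R" "0 < t"
  shows "((\<lambda>s. R / (1 + t * (s * R)\<^sup>2)) has_integral arctan (sqrt t * R) / sqrt t) {0..1}"
proof -
  have "((\<lambda>s. R / (1 + t * (s * R)\<^sup>2)) has_integral
       arctan (sqrt t * (1 * R)) / sqrt t - arctan (sqrt t * (0 * R)) / sqrt t) {0..1}"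
  proof (rule fundamental_theorem_of_calculus)
    fix s :: real
    have "((\<lambda>s. arctan (sqrt t * (s * R)) / sqrt t) has_real_derivative
        inverse (1 + (sqrt t * (s * R))\<^sup>2) * (sqrt t * R) / sqrt t) (at s within {0..1})"
      using assms by (auto intro!: derivative_eq_intros simp: mult.assoc)
    also have "inverse (1 + (sqrt t * (s * R))\<^sup>2) * (sqrt t * R) / sqrt t = R / (1 + t * (s * R)\<^sup>2)"
      using assms by (simp add: power_mult_distrib divide_simps)
    finally have "((\<lambda>s. arctan (sqrt t * (s * R)) / sqrt t) has_real_derivative R / (1 + t * (s * R)\<^sup>2))
       (at s within {0..1})" .
    then show "((\<lambda>s. arctan (sqrt t * (s * R)) / sqrt t) has_vector_derivative R / (1 + t * (s * R)\<^sup>2))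
       (at s within {0..1})"
      by (simp add: has_real_derivative_iff_has_vector_derivative)
  qed simp
  then show ?thesis by simp
qed


lemma norm_diagonal_contour_integral_le:
  fixes g :: "complex \<Rightarrow> complex"
  assumes cont: "continuous_on (closed_segment 0 (Complex R (- R))) g" and "0 < R" "0 < t"
    and bound: "\<And>s. 0 \<le> s \<Longrightarrow> norm (g (Complex s (- s))) \<le> M"
  shows "norm (contour_integral (linepath (Complex R (- R)) 0)
           (\<lambda>w. g w * exp (- \<i> * (w\<^sup>2 / 2) * of_real t))) \<le> M * pi / sqrt t"
proof -
  define f where "f w = g w * exp (- \<i> * (w\<^sup>2 / 2) * of_real t)" for w
  have "norm (g (Complex 1 (- 1))) \<le> M" using bound[of 1] by simp
  then have M: "0 \<le> M" using norm_ge_zero[of "g (Complex 1 (- 1))"] by linarith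
  have eq: "linepath 0 (Complex R (- R)) s = Complex (s * R) (- (s * R))" for s
    by (simp add: linepath_def complex_eq_iff)
  have "continuous_on (closed_segment 0 (Complex R (- R))) f"
    unfolding f_def by (intro continuous_intros cont) auto
  then have "f contour_integrable_on linepath 0 (Complex R (- R))"
    by (rule contour_integrable_continuous_linepath)
  then have int: "((\<lambda>s. f (linepath 0 (Complex R (- R)) s) * (Complex R (- R) - 0)) has_integral
      contour_integral (linepath 0 (Complex R (- R))) f) {0..1}"
    using has_contour_integral_integral has_contour_integral_linepath by blast
  have "norm (integral {0..1} (\<lambda>s. f (linepath 0 (Complex R (- R)) s) * (Complex R (- R) - 0)))
      \<le> integral {0..1} (\<lambda>s. 2 * M * (R / (1 + t * (s * R)\<^sup>2)))"
  proof (rule integral_norm_bound_integral)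
    show "(\<lambda>s. f (linepath 0 (Complex R (- R)) s) * (Complex R (- R) - 0)) integrable_on {0..1}"
      using int by blast
    show "(\<lambda>s. 2 * M * (R / (1 + t * (s * R)\<^sup>2))) integrable_on {0..1}"
      using has_integral_mult_right[OF has_integral_lorentzian[OF assms(2,3)]] by (rule has_integral_integrable)
    fix s :: real assume s: "s \<in> {0..1}"
    \<comment> \<open>On the diagonal \<open>w^2\<close> is \<open>- 2 i (s R)^2\<close>, so the
      oscillating factor is a genuine Gaussian.\<close>
    have "Re (- \<i> * ((Complex (s * R) (- (s * R)))\<^sup>2 / 2) * of_real t) = - (t * (s * R)\<^sup>2)"
      by (simp add: Im_power2 power2_eq_square)
    then have "norm (f (linepath 0 (Complex R (- R)) s)) \<le> M * exp (- (t * (s * R)\<^sup>2))"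
      using bound[of "s * R"] s \<open>0 < R\<close> M
      unfolding f_def eq norm_mult norm_exp_eq_Re by (intro mult_mono) auto
    also have "exp (- (t * (s * R)\<^sup>2)) \<le> 1 / (1 + t * (s * R)\<^sup>2)"
      using exp_ge_add_one_self[of "t * (s * R)\<^sup>2"] \<open>0 < t\<close>
      by (simp add: exp_minus field_simps add_pos_nonneg)
    finally have 1: "norm (f (linepath 0 (Complex R (- R)) s)) \<le> M * (1 / (1 + t * (s * R)\<^sup>2))"
      using M by (simp add: mult_left_mono)
    \<comment> \<open>The crude bound 2 for \<open>sqrt 2\<close>, times \<open>pi / 2\<close> from
      the arctangent, yields the constant \<open>pi\<close>.\<close>
    have 2: "norm (Complex R (- R) - 0) \<le> 2 * R"
      using cmod_le[of "Complex R (- R)"] \<open>0 < R\<close> by simp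
    have "norm (f (linepath 0 (Complex R (- R)) s) * (Complex R (- R) - 0))
        \<le> M * (1 / (1 + t * (s * R)\<^sup>2)) * (2 * R)"
      unfolding norm_mult using M \<open>0 < t\<close> by (intro mult_mono 1 2) auto
    then show "norm (f (linepath 0 (Complex R (- R)) s) * (Complex R (- R) - 0))
        \<le> 2 * M * (R / (1 + t * (s * R)\<^sup>2))"
      by (simp add: mult_ac)
  qed
  also have "\<dots> = 2 * M * (arctan (sqrt t * R) / sqrt t)"
    using has_integral_mult_right[OF has_integral_lorentzian[OF assms(2,3)]] by (rule integral_unique)
  also have "\<dots> \<le> 2 * M * ((pi / 2) / sqrt t)"
    using M arctan_ubound[of "sqrt t * R"] \<open>0 < t\<close>
    by (intro mult_left_mono divide_right_mono) auto
  finally have "norm (contour_integral (linepath 0 (Complex R (- R))) f) \<le> M * pi / sqrt t"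
    unfolding integral_unique[OF int] by simp
  then show ?thesis
    using contour_integral_reversepath[of "linepath 0 (Complex R (- R))" f] unfolding f_def by simp
qed

text \<open>The exponential contributes only the factor 1 and the side has length \<open>R\<close>.
  The estimate becomes useful because \<open>rotate_to_diagonal\<close> supplies an \<open>M\<close>
  of order \<open>R^(-3)\<close>.\<close>

lemma norm_vertical_contour_integral_le:
  fixes g :: "complex \<Rightarrow> complex"
  assumes cont: "continuous_on (closed_segment (of_real R) (Complex R (- R))) g" and "0 < R" "0 < t"
    and bound: "\<And>w. w \<in> wedge \<Longrightarrow> R \<le> norm w \<Longrightarrow> norm (g w) \<le> M"
  shows "norm (contour_integral (linepath (of_real R) (Complex R (- R)))
           (\<lambda>w. g w * exp (- \<i> * (w\<^sup>2 / 2) * of_real t))) \<le> M * R"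
proof -
  define f where "f w = g w * exp (- \<i> * (w\<^sup>2 / 2) * of_real t)" for w
  have seg: "w \<in> wedge \<and> R \<le> norm w" if "w \<in> closed_segment (of_real R) (Complex R (- R))" for w
  proof -
    from that obtain u where u: "0 \<le> u" "u \<le> 1" "w = (1 - u) *\<^sub>R of_real R + u *\<^sub>R Complex R (- R)"
      unfolding in_segment(1) by (elim exE conjE)
    have w: "Re w = R" "Im w = - (u * R)" unfolding u(3) by (simp_all add: algebra_simps)
    have "u * R \<le> R" using u \<open>0 < R\<close> by (simp add: mult_left_le_one_le)
    then show ?thesis
      using w u(1) \<open>0 < R\<close> complex_Re_le_cmod[of w] by (auto simp: wedge_def)
  qed
  have "continuous_on (closed_segment (of_real R) (Complex R (- R))) f"
    unfolding f_def by (intro continuous_intros cont) auto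
  then have int: "f contour_integrable_on linepath (of_real R) (Complex R (- R))"
    by (rule contour_integrable_continuous_linepath)
  have "norm (g (of_real R)) \<le> M" using \<open>0 < R\<close> by (intro bound) (auto simp: wedge_def)
  then have M: "0 \<le> M" using norm_ge_zero[of "g (of_real R)"] by linarith
  have "norm (contour_integral (linepath (of_real R) (Complex R (- R))) f)
      \<le> M * norm (Complex R (- R) - of_real R)"
  proof (rule contour_integral_bound_linepath[OF int M])
    fix w assume "w \<in> closed_segment (of_real R) (Complex R (- R))"
    then have "norm (g w) * norm (exp (- \<i> * (w\<^sup>2 / 2) * of_real t)) \<le> M * 1"
      using seg[of w] bound M norm_exp_quadratic_le \<open>0 < t\<close> by (intro mult_mono) auto
    then show "norm (f w) \<le> M" by (simp add: f_def norm_mult)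
  qed
  also have "Complex R (- R) - of_real R = Complex 0 (- R)" by (simp add: complex_eq_iff)
  finally show ?thesis using \<open>0 < R\<close> unfolding f_def by (simp add: cmod_def)
qed

text \<open>A triangle suffices in place of a sector: on its vertical side the exponential is bounded by 1.\<close>

lemma contour_integral_triangle_split:
  fixes f :: "complex \<Rightarrow> complex"
  assumes cont: "continuous_on wedge f" and z: "0 < - Im z" "- Im z < Re z" "Re z < R" and "z \<in> wedge"
    and hol: "\<And>w. 0 < - Im w \<Longrightarrow> - Im w < Re w \<Longrightarrow> f field_differentiable at w"
  shows "contour_integral (linepath 0 (of_real R)) (\<lambda>w. f w / (w - z))
      + contour_integral (linepath (of_real R) (Complex R (- R))) (\<lambda>w. f w / (w - z))
      + contour_integral (linepath (Complex R (- R)) 0) (\<lambda>w. f w / (w - z))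
      = - (2 * pi * \<i> * f z)"
proof -
  let ?g = "linepath 0 (of_real R) +++ linepath (of_real R) (Complex R (- R)) +++ linepath (Complex R (- R)) 0"
  let ?T = "convex hull {0, of_real R, Complex R (- R)}"
  have R: "0 < R" using z by linarith
  have zI: "z \<in> interior ?T"
    using interior_triangle[OF R] z by simp
  have pi: "path_image ?g = closed_segment 0 (of_real R) \<union> closed_segment (of_real R) (Complex R (- R))
       \<union> closed_segment (Complex R (- R)) 0"
    by (simp add: path_image_join Un_assoc)
  have "z \<notin> path_image ?g"
    using zI by (auto simp: pi interior_of_triangle)
  moreover have "path_image ?g \<subseteq> ?T"
    unfolding pi by (intro Un_least closed_segment_subset convex_convex_hull hull_inc) auto
  ultimately have path: "path_image ?g \<subseteq> ?T - {z}" by blast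
  \<comment> \<open>The weak form of Cauchy's formula asks for holomorphy in the interior only and
    for continuity up to the boundary, which is all that is known of \<open>f\<close> on the real
    axis and on the diagonal.\<close>
  have "((\<lambda>w. f w / (w - z)) has_contour_integral (2 * pi * \<i> * winding_number ?g z * f z)) ?g"
  proof (rule Cauchy_integral_formula_weak[where S = ?T and k = "{}"])
    show "continuous_on ?T f"
      using cont by (rule continuous_on_subset) (use triangle_subset_wedge[OF R] in auto)
    show "f field_differentiable at x" if "x \<in> interior ?T - {}" for x
      using that hol unfolding interior_triangle[OF R] by simp
  qed (use path zI in auto)
  \<comment> \<open>The path 0, \<open>R\<close>, \<open>R - i R\<close>, 0 runs clockwise.\<close>
  moreover have "winding_number ?g z = -1"
    using winding_number_triangle[OF zI] z R by (simp add: zero_less_mult_iff)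
  ultimately have total: "((\<lambda>w. f w / (w - z)) has_contour_integral - (2 * pi * \<i> * f z)) ?g"
    by simp
  then have "(\<lambda>w. f w / (w - z)) contour_integrable_on ?g"
    by (auto simp: contour_integrable_on_def)
  then show ?thesis
    using contour_integral_unique[OF total] by (simp add: add.assoc)
qed

text \<open>Cauchy's formula on the triangle of size \<open>R\<close> expresses the integral over
  \<open>[0, R]\<close> as minus the residue term minus the two other sides. As \<open>R\<close>
  grows the vertical side vanishes by \<open>decay\<close>, while the diagonal bound is independent
  of \<open>R\<close>.\<close>

lemma rotate_to_diagonal:
  fixes h :: "complex \<Rightarrow> complex"
  assumes cont: "continuous_on wedge h"
    and hol: "\<And>w. 0 < - Im w \<Longrightarrow> - Im w < Re w \<Longrightarrow> h field_differentiable at w"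
    and z: "0 < - Im z" "- Im z < Re z"
    and decay: "\<And>w. w \<in> wedge \<Longrightarrow> R0 \<le> norm w \<Longrightarrow> norm (h w) \<le> B / (norm w)\<^sup>2"
    and diag: "\<And>s. 0 \<le> s \<Longrightarrow> norm (h (Complex s (- s)) / (Complex s (- s) - z)) \<le> M"
    and "0 < t"
  shows "norm ((LINT k:{0<..}|lborel. h (of_real k) / (of_real k - z) * exp (- \<i> * of_real (k\<^sup>2 / 2) * of_real t))
      + 2 * pi * \<i> * h z * exp (- \<i> * (z\<^sup>2 / 2) * of_real t)) \<le> M * pi / sqrt t"
proof -
  define e where "e w = exp (- \<i> * (w\<^sup>2 / 2) * of_real t)" for w
  define f where "f w = h w / (w - z) * e w" for w
  have e_le: "norm (e w) \<le> 1" if "w \<in> wedge" for w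
    using norm_exp_quadratic_le[OF that \<open>0 < t\<close>] by (simp add: e_def)
  \<comment> \<open>Beyond \<open>R1\<close> the decay of \<open>h\<close> is available,
    \<open>norm (w - z)\<close> is at least half of \<open>norm w\<close>, and
    \<open>1 / x^3\<close> is below \<open>1 / x^2\<close>.\<close>
  define R1 where "R1 = max (max R0 1) (2 * norm z + 1)"
  have R1: "R0 \<le> R1" "1 \<le> R1" "2 * norm z < R1" by (auto simp: R1_def)
  have B: "0 \<le> B"
  proof -
    have "(0::real) \<le> norm (h (of_real R1))" by simp
    also have "\<dots> \<le> B / R1\<^sup>2" using decay[of "of_real R1"] R1 by (auto simp: wedge_def)
    finally show ?thesis using R1 by (simp add: zero_le_divide_iff)
  qed
  have real_wedge: "of_real x \<in> wedge" if "0 \<le> x" for x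
    using that by (simp add: wedge_def)
  have decay': "norm (h w / (w - z)) \<le> 2 * B / norm w ^ 3"
    if "w \<in> wedge" "R1 \<le> norm w" for w
  proof -
    have "norm w \<le> 2 * norm (w - z)"
      using that R1 norm_triangle_ineq2[of w z] by linarith
    moreover have "norm (h w) \<le> B / (norm w)\<^sup>2" using that R1 by (intro decay) auto
    moreover have "0 < norm w" using that R1 by linarith
    ultimately have "norm (h w) / norm (w - z) \<le> (B / (norm w)\<^sup>2) / (norm w / 2)"
      using B by (intro frac_le) auto
    then show ?thesis by (simp add: norm_divide power3_eq_cube power2_eq_square mult_ac)
  qed
  have zreal: "of_real x \<noteq> z" for x using z by (auto simp: complex_eq_iff)
  have "continuous_on {0..} (\<lambda>x. h (of_real x))"
    by (rule continuous_on_compose2[OF cont]) (auto intro: continuous_intros simp: wedge_def)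
  then have contf: "continuous_on {0..} (\<lambda>x. f (of_real x))"
    unfolding f_def e_def using zreal by (intro continuous_intros) auto
  have int: "set_integrable lborel {0..} (\<lambda>x. f (of_real x))"
  proof (rule set_integrable_atLeast_inverse_square[OF contf])
    fix x assume x: "R1 \<le> x"
    have "norm (f (of_real x)) \<le> (2 * B / x ^ 3) * 1"
      unfolding f_def norm_mult using decay'[of "of_real x"] e_le real_wedge[of x] x R1 B
      by (intro mult_mono) auto
    also have "\<dots> \<le> 2 * B / x ^ 2"
      using x R1 B power_increasing[of 2 3 x] by (simp add: divide_left_mono)
    finally show "norm (f (of_real x)) \<le> 2 * B / x\<^sup>2" .
  qed (use R1 in auto)
  then have "((\<lambda>R. LINT x:{0..R}|lborel. f (of_real x)) \<longlongrightarrow> (LINT x:{0..}|lborel. f (of_real x))) at_top"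
    by (intro tendsto_set_lebesgue_integral_at_top) auto
  moreover have "(LINT x:{0..}|lborel. f (of_real x)) = (LINT x:{0<..}|lborel. f (of_real x))"
    unfolding set_lebesgue_integral_def
    by (rule integral_discrete_difference[of "{0}"]) (auto simp: indicator_def)
  ultimately have lim: "((\<lambda>R. (LINT x:{0..R}|lborel. f (of_real x)) + 2 * pi * \<i> * h z * e z)
      \<longlongrightarrow> (LINT x:{0<..}|lborel. f (of_real x)) + 2 * pi * \<i> * h z * e z) at_top"
    by (intro tendsto_add tendsto_const) simp
  have "norm ((LINT x:{0<..}|lborel. f (of_real x)) + 2 * pi * \<i> * h z * e z) \<le> M * pi / sqrt t"
  \<comment> \<open>The estimate is proved for each large \<open>R\<close> with the extra term
    \<open>2 B / R^2\<close> from the vertical side, which disappears in the limit.\<close>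
  proof (rule tendsto_le[OF _ _ tendsto_norm[OF lim]])
    have "((\<lambda>R. 2 * B / R ^ 2 + M * pi / sqrt t) \<longlongrightarrow> 0 + M * pi / sqrt t) at_top"
      by (intro tendsto_add tendsto_const tendsto_divide_0[OF tendsto_const]
          filterlim_at_top_imp_at_infinity filterlim_pow_at_top filterlim_ident) auto
    then show "((\<lambda>R. 2 * B / R ^ 2 + M * pi / sqrt t) \<longlongrightarrow> M * pi / sqrt t) at_top"
      by simp
    show "eventually (\<lambda>R. norm ((LINT x:{0..R}|lborel. f (of_real x)) + 2 * pi * \<i> * h z * e z)
        \<le> 2 * B / R ^ 2 + M * pi / sqrt t) at_top"
      using eventually_gt_at_top[of R1]
    proof eventually_elim
      case (elim R)
      then have R: "0 < R" "Re z < R" using R1 complex_Re_le_cmod[of z] by auto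
      have "set_integrable lborel {0..R} (\<lambda>x. f (of_real x))"
        by (rule set_integrable_subset[OF int]) auto
      then have I1: "(LINT x:{0..R}|lborel. f (of_real x)) = contour_integral (linepath 0 (of_real R)) f"
        using R contour_integral_linepath_Reals_eq[of 0 "of_real R" f]
        by (simp add: set_borel_integral_eq_integral)
      have eq: "f = (\<lambda>w. h w * e w / (w - z))" by (simp add: f_def fun_eq_iff)
      have "contour_integral (linepath 0 (of_real R)) f
          + contour_integral (linepath (of_real R) (Complex R (- R))) f
          + contour_integral (linepath (Complex R (- R)) 0) f = - (2 * pi * \<i> * (h z * e z))"
        unfolding eq
      proof (rule contour_integral_triangle_split)
        show "continuous_on wedge (\<lambda>w. h w * e w)"
          unfolding e_def by (intro continuous_intros cont) auto
        show "(\<lambda>w. h w * e w) field_differentiable at w" if "0 < - Im w" "- Im w < Re w" for w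
        proof -
          have "e holomorphic_on UNIV" unfolding e_def by (intro holomorphic_intros) auto
          then have "e field_differentiable at w" by (simp add: holomorphic_on_def)
          then show ?thesis using hol[OF that] by (intro derivative_intros)
        qed
      qed (use z R in \<open>auto simp: wedge_def\<close>)
      then have split: "(LINT x:{0..R}|lborel. f (of_real x)) + 2 * pi * \<i> * h z * e z
          = - contour_integral (linepath (of_real R) (Complex R (- R))) f
            - contour_integral (linepath (Complex R (- R)) 0) f"
        unfolding I1 by algebra
      have seg: "closed_segment (of_real R) (Complex R (- R)) \<subseteq> wedge - {z}"
        "closed_segment 0 (Complex R (- R)) \<subseteq> wedge - {z}"
      proof -
        have "z \<notin> closed_segment (of_real R) (Complex R (- R))" "z \<notin> closed_segment 0 (Complex R (- R))"
          using interior_triangle[OF R(1)] z R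
          by (auto simp: interior_of_triangle closed_segment_commute)
        moreover have "closed_segment (of_real R) (Complex R (- R)) \<subseteq> convex hull {0, of_real R, Complex R (- R)}"
          "closed_segment 0 (Complex R (- R)) \<subseteq> convex hull {0, of_real R, Complex R (- R)}"
          by (intro closed_segment_subset convex_convex_hull hull_inc; simp)+
        ultimately show "closed_segment (of_real R) (Complex R (- R)) \<subseteq> wedge - {z}"
          "closed_segment 0 (Complex R (- R)) \<subseteq> wedge - {z}"
          using triangle_subset_wedge[OF R(1)] by blast+
      qed
      have contg: "continuous_on (wedge - {z}) (\<lambda>w. h w / (w - z))"
        by (intro continuous_intros continuous_on_subset[OF cont]) auto
      have "norm (contour_integral (linepath (of_real R) (Complex R (- R))) f) \<le> 2 * B / R ^ 3 * R"
        unfolding f_def e_def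
      proof (rule norm_vertical_contour_integral_le[OF continuous_on_subset[OF contg seg(1)] R(1) \<open>0 < t\<close>])
        fix w assume "w \<in> wedge" "R \<le> norm w"
        then have "norm (h w / (w - z)) \<le> 2 * B / norm w ^ 3"
          using elim by (intro decay') auto
        also have "\<dots> \<le> 2 * B / R ^ 3"
          using \<open>R \<le> norm w\<close> R B by (intro frac_le power_mono) auto
        finally show "norm (h w / (w - z)) \<le> 2 * B / R ^ 3" .
      qed
      moreover have "2 * B / R ^ 3 * R = 2 * B / R ^ 2"
        using R by (simp add: power3_eq_cube power2_eq_square)
      moreover have "norm (contour_integral (linepath (Complex R (- R)) 0) f) \<le> M * pi / sqrt t"
        unfolding f_def e_def
        by (rule norm_diagonal_contour_integral_le[OF continuous_on_subset[OF contg seg(2)] R(1) \<open>0 < t\<close> diag])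
      ultimately show ?case
        unfolding split using norm_triangle_ineq4 by (smt (verit) norm_minus_cancel)
    qed
  qed simp
  then show ?thesis by (simp add: f_def e_def)
qed

subsection \<open>The integrand in the closed sector\<close>

text \<open>The branch of the square root of \<open>k\<^sup>2 - 2 lam\<close> that is continuous on \<open>wedge\<close> up to the real
  axis, where \<open>ktilde\<close> jumps for \<open>k < sqrt (2 lam)\<close>; it has values in the closed fourth quadrant.\<close>

definition ktilde_low :: "real \<Rightarrow> complex \<Rightarrow> complex" where
  "ktilde_low lam k = csqrt (\<i> * (k\<^sup>2 - 2 * of_real lam)) * (1 - \<i>) / of_real (sqrt 2)"

lemma ktilde_low_square: "(ktilde_low lam k)\<^sup>2 = k\<^sup>2 - 2 * of_real lam"
proof -
  have "(of_real (sqrt 2) :: complex)\<^sup>2 = 2" by (simp flip: of_real_power)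
  moreover have "(1 - \<i>)\<^sup>2 = - 2 * \<i>" by (simp add: power2_eq_square algebra_simps)
  ultimately have "(ktilde_low lam k)\<^sup>2 = \<i> * (k\<^sup>2 - 2 * of_real lam) * (- 2 * \<i>) / 2"
    by (simp add: ktilde_low_def power_mult_distrib power_divide)
  also have "\<dots> = k\<^sup>2 - 2 * of_real lam" by (simp add: field_simps)
  finally show ?thesis .
qed

text \<open>The square of \<open>v\<close> has nonnegative real part on \<open>wedge\<close>, so the
  argument of \<open>v\<close> is at most \<open>pi / 4\<close> in modulus; the factor
  \<open>(1 - i) / sqrt 2\<close> turns it by \<open>- pi / 4\<close> into the fourth
  quadrant.\<close>

lemma ktilde_low_quadrant:
  assumes "k \<in> wedge"
  shows "0 \<le> Re (ktilde_low lam k)" "Im (ktilde_low lam k) \<le> 0"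
proof -
  define v where "v = csqrt (\<i> * (k\<^sup>2 - 2 * of_real lam))"
  have "Re v \<ge> 0" unfolding v_def by (rule Re_csqrt)
  have "Re (v\<^sup>2) = - 2 * Re k * Im k" by (simp add: v_def Im_power2)
  also have "\<dots> \<ge> 0" using assms by (simp add: wedge_def mult_nonneg_nonpos)
  finally have "(Im v)\<^sup>2 \<le> (Re v)\<^sup>2" by (simp add: Re_power2)
  then have "\<bar>Im v\<bar> \<le> Re v" using \<open>Re v \<ge> 0\<close> by (simp add: abs_le_square_iff[symmetric])
  moreover have "ktilde_low lam k = Complex ((Re v + Im v) / sqrt 2) ((Im v - Re v) / sqrt 2)"
    by (simp add: ktilde_low_def flip: v_def) (simp add: complex_eq_iff Re_divide_of_real Im_divide_of_real)
  ultimately show "0 \<le> Re (ktilde_low lam k)" "Im (ktilde_low lam k) \<le> 0"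
    by (simp_all add: divide_le_0_iff)
qed

text \<open>Strictly below the real axis \<open>k^2\<close> has negative imaginary part, so the root
  cannot be purely imaginary; its nonnegative real part is then positive, which marks the principal
  root.\<close>

lemma ktilde_low_eq_ktilde:
  assumes "k \<in> wedge" "Re k > 0" "Im k < 0"
  shows "ktilde_low lam k = ktilde lam k"
proof -
  have "2 * Re (ktilde_low lam k) * Im (ktilde_low lam k) = Im ((ktilde_low lam k)\<^sup>2)"
    by (simp add: Im_power2)
  also have "\<dots> = 2 * Re k * Im k" by (simp add: ktilde_low_square Im_power2)
  also have "\<dots> < 0" using assms by (simp add: mult_pos_neg)
  finally have "Re (ktilde_low lam k) \<noteq> 0" by auto
  then show ?thesis
    unfolding ktilde_def using ktilde_low_square ktilde_low_quadrant[OF assms(1), of lam]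
    by (intro csqrt_unique[symmetric]) auto
qed

text \<open>The closed half-plane meets the branch cut only at 0, and there the modulus
  \<open>sqrt (norm w)\<close> forces continuity.\<close>

lemma continuous_on_csqrt_right_halfplane: "continuous_on {w. 0 \<le> Re w} csqrt"
  unfolding continuous_on_eq_continuous_within
proof
  fix w :: complex assume w: "w \<in> {w. 0 \<le> Re w}"
  show "continuous (at w within {w. 0 \<le> Re w}) csqrt"
  proof (cases "w = 0")
    case True
    have "((\<lambda>w. sqrt (norm w)) \<longlongrightarrow> sqrt (norm (0::complex))) (at 0 within {w. 0 \<le> Re w})"
      by (intro tendsto_intros)
    then have "(csqrt \<longlongrightarrow> 0) (at 0 within {w. 0 \<le> Re w})"
      by (simp add: tendsto_norm_zero_iff[of csqrt, symmetric])
    then show ?thesis using True by (simp add: continuous_within)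
  next
    case False
    then have "w \<notin> \<real>\<^sub>\<le>\<^sub>0" using w by (auto simp: complex_nonpos_Reals_iff complex_eq_iff)
    then show ?thesis by (rule continuous_within_csqrt)
  qed
qed

text \<open>On \<open>wedge\<close> the imaginary part of \<open>k^2\<close> is nonpositive, so
  \<open>i (k^2 - 2 lam)\<close> stays in the closed right half-plane.\<close>

lemma continuous_on_ktilde_low: "continuous_on wedge (ktilde_low lam)"
  unfolding ktilde_low_def
  by (intro continuous_intros continuous_on_compose2[OF continuous_on_csqrt_right_halfplane])
     (auto simp: wedge_def Im_power2 mult_nonneg_nonpos)

lemma ktilde_low_field_differentiable:
  assumes "0 < - Im k" "- Im k < Re k"
  shows "ktilde_low lam field_differentiable at k"
proof -
  let ?U = "{w. Re w > 0} \<inter> {w. Im w < 0}"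
  have "ktilde_low lam holomorphic_on ?U"
    unfolding ktilde_low_def
    by (intro holomorphic_intros)
       (auto simp: complex_nonpos_Reals_iff Im_power2 not_le mult_pos_neg mult_neg_pos)
  moreover have "open ?U" by (intro open_Int open_halfspace_Re_gt open_halfspace_Im_lt)
  ultimately show ?thesis
    using assms by (auto intro: holomorphic_on_imp_differentiable_at)
qed

text \<open>The two branches differ at most by sign, and \<open>cos (K z)\<close> and
  \<open>K sin (K z)\<close> are even in \<open>K\<close>.\<close>

lemma cos_sin_ktilde_low:
  "cos (ktilde lam k * z) = cos (ktilde_low lam k * z)"
  "ktilde lam k * sin (ktilde lam k * z) = ktilde_low lam k * sin (ktilde_low lam k * z)"
proof -
  have "(ktilde lam k)\<^sup>2 = (ktilde_low lam k)\<^sup>2"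
    by (simp add: ktilde_def ktilde_low_square)
  then have "ktilde lam k = ktilde_low lam k \<or> ktilde lam k = - ktilde_low lam k"
    by (simp add: power2_eq_iff)
  then show "cos (ktilde lam k * z) = cos (ktilde_low lam k * z)"
    "ktilde lam k * sin (ktilde lam k * z) = ktilde_low lam k * sin (ktilde_low lam k * z)"
    by auto
qed

section \<open>Lower bound and absence of zeros for the Jost function in the sector\<close>

lemma le_sinh_real:
  fixes x :: real
  assumes "0 \<le> x"
  shows "x \<le> sinh x"
proof -
  have "sinh 0 - 0 \<le> sinh x - x"
    using assms by (rule DERIV_nonneg_imp_nondecreasing[where f = "\<lambda>x. sinh x - x"])
      (auto intro!: exI derivative_eq_intros simp: cosh_real_ge_1)
  then show ?thesis by simp
qed

text \<open>By the product formula the imaginary part is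
  \<open>(- Re K sinh Y + Im K sin X) / 2\<close> with \<open>X = 2 a Re K\<close> and
  \<open>Y = - 2 a Im K\<close>. Replacing \<open>sinh Y\<close> by \<open>Y\<close> and
  \<open>sin X\<close> by \<open>- X\<close> can only increase it, and the two resulting terms
  cancel exactly.\<close>

lemma Im_mult_sin_cnj_cos_le_0:
  fixes K :: complex and a :: real
  assumes "0 \<le> a" "0 \<le> Re K" "Im K \<le> 0"
  shows "Im (K * sin (K * of_real a) * cnj (cos (K * of_real a))) \<le> 0"
proof -
  define X where "X = 2 * a * Re K"
  define Y where "Y = - (2 * a * Im K)"
  have XY: "0 \<le> X" "0 \<le> Y" using assms by (auto simp: X_def Y_def mult_nonneg_nonpos)
  have "sin (K * of_real a) * cnj (cos (K * of_real a))
      = (sin (of_real X) + sin (- (\<i> * of_real Y))) / 2"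
    unfolding cnj_cos sin_times_cos
    by (intro arg_cong2[where f = "\<lambda>x y. (sin x + sin y) / 2"]) (auto simp: complex_eq_iff X_def Y_def)
  also have "\<dots> = Complex (sin X / 2) (- sinh Y / 2)"
    by (simp add: complex_eq_iff Re_sin Im_sin sinh_def)
  finally have "Im (K * sin (K * of_real a) * cnj (cos (K * of_real a)))
      = Re K * (- sinh Y / 2) + Im K * (sin X / 2)"
    by (simp add: mult.assoc)
  also have "Re K * (- sinh Y / 2) \<le> Re K * (- Y / 2)"
    using assms XY by (intro mult_left_mono) (auto simp: le_sinh_real)
  also have "Im K * (sin X / 2) \<le> Im K * (- X / 2)"
    using assms XY abs_sin_x_le_abs_x[of X] by (intro mult_left_mono_neg) auto
  finally show ?thesis by (simp add: X_def Y_def)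
qed


text \<open>\<open>k\<close> times the continuation of \<open>Fbar\<close>; multiplying by \<open>k\<close> removes the pole at 0.\<close>

definition jost :: "real \<Rightarrow> complex \<Rightarrow> complex \<Rightarrow> complex" where
  "jost a k K = k * cos (K * of_real a) + \<i> * (K * sin (K * of_real a))"

lemma Re_jost_cnj_cos:
  assumes "0 \<le> a" "0 \<le> Re K" "Im K \<le> 0"
  shows "Re k * (norm (cos (K * of_real a)))\<^sup>2 \<le> Re (jost a k K * cnj (cos (K * of_real a)))"
proof -
  let ?c = "cos (K * of_real a)"
  have "jost a k K * cnj ?c = k * (?c * cnj ?c) + \<i> * (K * sin (K * of_real a) * cnj ?c)"
    by (simp add: jost_def algebra_simps)
  also have "\<dots> = k * of_real ((norm ?c)\<^sup>2) + \<i> * (K * sin (K * of_real a) * cnj ?c)"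
    by (simp only: complex_norm_square)
  finally have "Re (jost a k K * cnj ?c) = Re k * (norm ?c)\<^sup>2 - Im (K * sin (K * of_real a) * cnj ?c)"
    by simp
  then show ?thesis using Im_mult_sin_cnj_cos_le_0[OF assms] by linarith
qed

lemma Re_mult_norm_cos_le_norm_jost:
  assumes "0 \<le> a" "0 \<le> Re K" "Im K \<le> 0"
  shows "Re k * norm (cos (K * of_real a)) \<le> norm (jost a k K)"
proof (cases "cos (K * of_real a) = 0")
  case False
  have "Re k * (norm (cos (K * of_real a)))\<^sup>2 \<le> norm (jost a k K * cnj (cos (K * of_real a)))"
    using Re_jost_cnj_cos[OF assms, of k] complex_Re_le_cmod order_trans by blast
  then have "(Re k * norm (cos (K * of_real a))) * norm (cos (K * of_real a))
      \<le> norm (jost a k K) * norm (cos (K * of_real a))"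
    by (simp add: norm_mult power2_eq_square mult.assoc)
  then show ?thesis using False by simp
qed auto

text \<open>For \<open>k \<noteq> 0\<close> in the sector \<open>Re k > 0\<close>, so a zero would
  force \<open>cos (K a) = 0\<close> and then \<open>K sin (K a) = 0\<close>, against
  \<open>cos^2 + sin^2 = 1\<close>. At \<open>k = 0\<close> the lower bound is void, but
  \<open>K\<close> is \<open>- i sqrt (2 lam)\<close> and the sine becomes a nonzero
  \<open>sinh\<close>.\<close>

lemma jost_nonzero:
  assumes "0 < a" "0 < lam" "k \<in> wedge"
  shows "jost a k (ktilde_low lam k) \<noteq> 0"
proof
  define K where "K = ktilde_low lam k"
  assume "jost a k (ktilde_low lam k) = 0"
  then have j: "jost a k K = 0" by (simp add: K_def)
  have K: "0 \<le> Re K" "Im K \<le> 0" using ktilde_low_quadrant[OF assms(3)] by (auto simp: K_def)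
  have K2: "K\<^sup>2 = k\<^sup>2 - 2 * of_real lam" by (simp add: K_def ktilde_low_square)
  have k: "k = 0 \<or> 0 < Re k"
    using assms(3) by (auto simp: wedge_def complex_eq_iff)
  have sq: "(cos (K * of_real a))\<^sup>2 + (sin (K * of_real a))\<^sup>2 = 1" by (simp add: add.commute)
  show False
  proof (cases "k = 0")
    case True
    then have "K \<noteq> 0" using K2 assms by auto
    then have "sin (K * of_real a) = 0" using j True by (simp add: jost_def)
    moreover have "K = - \<i> * of_real (sqrt (2 * lam))"
    proof -
      have "K\<^sup>2 = (- \<i> * of_real (sqrt (2 * lam)))\<^sup>2"
        using K2 True assms by (simp add: power_mult_distrib flip: of_real_power)
      then have "K = - \<i> * of_real (sqrt (2 * lam)) \<or> K = - (- \<i> * of_real (sqrt (2 * lam)))"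
        by (simp only: power2_eq_iff)
      then show ?thesis using K assms by auto
    qed
    ultimately have "sin (\<i> * of_real (sqrt (2 * lam) * a)) = 0" by (simp add: mult.assoc)
    then have "sinh (sqrt (2 * lam) * a) = 0"
      by (simp add: complex_eq_iff Im_sin sinh_def)
    then show False using assms by simp
  next
    case False
    then have "norm (cos (K * of_real a)) \<le> 0"
      using k Re_mult_norm_cos_le_norm_jost[of a K k] j K assms by (simp add: mult_le_0_iff)
    then have c: "cos (K * of_real a) = 0" by simp
    then have "K = 0 \<or> sin (K * of_real a) = 0" using j by (simp add: jost_def)
    then show False using c sq by auto
  qed
qed

section \<open>The amplitude: regularity and size\<close>

definition cos_quotient :: "real \<Rightarrow> real \<Rightarrow> complex \<Rightarrow> complex" where
  "cos_quotient a b K =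
     (if K = of_real b then deriv (\<lambda>w. cos (w * of_real a)) (of_real b)
      else (cos (K * of_real a) - cos (of_real b * of_real a)) / (K - of_real b))"

text \<open>Subtracting \<open>cos (b a)\<close> makes the singularity at \<open>b\<close> removable
  for every \<open>b\<close>. In the application this value is 0, so the quotient is
  \<open>cos (K a) / (K - b)\<close>.\<close>

lemma holomorphic_on_cos_quotient: "cos_quotient a b holomorphic_on UNIV"
  unfolding cos_quotient_def by (intro pole_lemma holomorphic_intros) auto

text \<open>\<open>psi_hat * eta\<close> is a constant multiple of \<open>amplitude / (k - z)\<close>; \<open>cos_quotient\<close> removes the singularity
  at \<open>k\<^sup>2 = 2 lam + b\<^sup>2\<close>.\<close>

definition amplitude :: "real \<Rightarrow> real \<Rightarrow> real \<Rightarrow> complex \<Rightarrow> complex" where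
  "amplitude a lam b k = - (k * cos_quotient a b (ktilde_low lam k)) /
     ((of_real b + ktilde_low lam k) * jost a k (ktilde_low lam k))"

text \<open>Of the two factors of \<open>b^2 - K^2\<close> only \<open>b - K\<close> can vanish on
  the sector, because \<open>Re K \<ge> 0\<close>.\<close>

lemma ktilde_low_add_nonzero:
  assumes "0 < b" "k \<in> wedge"
  shows "of_real b + ktilde_low lam k \<noteq> 0"
  using ktilde_low_quadrant[OF assms(2), of lam] assms(1) by (auto simp: complex_eq_iff)

lemma continuous_on_amplitude:
  assumes "0 < a" "0 < lam" "0 < b"
  shows "continuous_on wedge (amplitude a lam b)"
  unfolding amplitude_def
proof (intro continuous_intros)
  show "continuous_on wedge (\<lambda>k. cos_quotient a b (ktilde_low lam k))"
    by (rule continuous_on_compose2[OF holomorphic_on_imp_continuous_on[OF holomorphic_on_cos_quotient]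
        continuous_on_ktilde_low]) auto
  show "continuous_on wedge (\<lambda>k. jost a k (ktilde_low lam k))"
    unfolding jost_def by (intro continuous_intros continuous_on_ktilde_low)
qed (use jost_nonzero ktilde_low_add_nonzero assms in \<open>auto intro: continuous_on_ktilde_low\<close>)

lemma amplitude_field_differentiable:
  assumes "0 < a" "0 < lam" "0 < b" "0 < - Im k" "- Im k < Re k"
  shows "amplitude a lam b field_differentiable at k"
proof -
  have K: "ktilde_low lam field_differentiable at k"
    using assms by (intro ktilde_low_field_differentiable)
  have k: "k \<in> wedge" using assms by (simp add: wedge_def)
  have "cos_quotient a b field_differentiable at (ktilde_low lam k)"
    using holomorphic_on_cos_quotient by (simp add: holomorphic_on_def)
  from field_differentiable_compose[OF K this]
  have 1: "(\<lambda>k. cos_quotient a b (ktilde_low lam k)) field_differentiable at k"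
    by (simp add: o_def)
  have "(\<lambda>w. cos (w * of_real a)) field_differentiable at (ktilde_low lam k)"
       "(\<lambda>w. sin (w * of_real a)) field_differentiable at (ktilde_low lam k)"
    by (auto simp: field_differentiable_def intro!: exI derivative_eq_intros)
  from this[THEN field_differentiable_compose[OF K]]
  have "(\<lambda>k. cos (ktilde_low lam k * of_real a)) field_differentiable at k"
       "(\<lambda>k. sin (ktilde_low lam k * of_real a)) field_differentiable at k"
    by (simp_all add: o_def)
  then have "(\<lambda>k. jost a k (ktilde_low lam k)) field_differentiable at k"
    unfolding jost_def by (intro derivative_intros K)
  then show ?thesis
    unfolding amplitude_def
    using jost_nonzero[OF assms(1,2) k] ktilde_low_add_nonzero[OF assms(3) k]
    by (intro derivative_intros K 1) auto
qed

lemma amplitude_eq: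
  assumes "cos (b * a) = 0" "(ktilde_low lam k)\<^sup>2 \<noteq> of_real (b\<^sup>2)"
  shows "amplitude a lam b k = k * cos (ktilde_low lam k * of_real a) /
     ((of_real (b\<^sup>2) - (ktilde_low lam k)\<^sup>2) * jost a k (ktilde_low lam k))"
proof -
  have ne: "ktilde_low lam k \<noteq> of_real b" "ktilde_low lam k \<noteq> - of_real b"
    using assms(2) by auto
  have "cos (complex_of_real b * of_real a) = 0"
    using assms(1) by (metis cos_of_real of_real_0 of_real_mult)
  then have "cos_quotient a b (ktilde_low lam k) = - cos (ktilde_low lam k * of_real a) / (of_real b - ktilde_low lam k)"
    using ne by (simp add: cos_quotient_def divide_simps) (simp add: algebra_simps)
  moreover have "of_real (b\<^sup>2) - (ktilde_low lam k)\<^sup>2 = (of_real b - ktilde_low lam k) * (of_real b + ktilde_low lam k)"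
    by (simp add: power2_eq_square algebra_simps)
  ultimately show ?thesis
    by (simp add: amplitude_def)
qed

text \<open>In the sector \<open>norm k \<le> 2 * Re k\<close>, so the lower bound for
  \<open>jost\<close> absorbs the numerator \<open>k cos (K a)\<close> at the cost of a factor 2,
  even where the cosine is exponentially large. What remains is
  \<open>b^2 - K^2 = b^2 + 2 lam - k^2\<close>.\<close>

lemma norm_amplitude_le:
  assumes "0 < a" "0 < lam" "cos (b * a) = 0" "k \<in> wedge" "k\<^sup>2 \<noteq> of_real (b\<^sup>2 + 2 * lam)"
  shows "norm (amplitude a lam b k) \<le> 2 / norm (of_real (b\<^sup>2 + 2 * lam) - k\<^sup>2)"
proof (cases "k = 0")
  case False
  define K where "K = ktilde_low lam k"
  have k: "0 < Re k" "norm k \<le> 2 * Re k"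
    using False assms(4) cmod_le[of k] by (auto simp: wedge_def complex_eq_iff)
  have diff: "of_real (b\<^sup>2) - K\<^sup>2 = of_real (b\<^sup>2 + 2 * lam) - k\<^sup>2"
    by (simp add: K_def ktilde_low_square)
  have "(ktilde_low lam k)\<^sup>2 \<noteq> of_real (b\<^sup>2)"
    using assms(5) by (auto simp: ktilde_low_square algebra_simps)
  from amplitude_eq[OF assms(3) this]
  have eq: "amplitude a lam b k = k * cos (K * of_real a) / ((of_real (b\<^sup>2 + 2 * lam) - k\<^sup>2) * jost a k K)"
    unfolding K_def[symmetric] diff .
  have K: "0 \<le> Re K" "Im K \<le> 0" using ktilde_low_quadrant[OF assms(4)] by (auto simp: K_def)
  have "norm k * norm (cos (K * of_real a)) \<le> 2 * (Re k * norm (cos (K * of_real a)))"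
    using mult_right_mono[OF k(2), of "norm (cos (K * of_real a))"] by simp
  also have "\<dots> \<le> 2 * norm (jost a k K)"
    using Re_mult_norm_cos_le_norm_jost[of a K k] K assms(1) by simp
  finally have "norm k * norm (cos (K * of_real a)) / norm (jost a k K) \<le> 2"
    using jost_nonzero[OF assms(1,2,4)] by (simp add: K_def divide_le_eq)
  from divide_right_mono[OF this, of "norm (of_real (b\<^sup>2 + 2 * lam) - k\<^sup>2)"]
  show ?thesis by (simp add: eq norm_mult norm_divide mult.commute)
qed (simp add: amplitude_def)

subsection \<open>The resonance\<close>

declare csqrt.simps [simp del]

text \<open>The derivative is \<open>1 / cos (Arcsin z)\<close> and \<open>cos^2 = 1 - z^2\<close>
  has modulus at least 3/4 on this disc.\<close>

lemma norm_Arcsin_diff_le: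
  assumes "norm z \<le> 1/2" "norm w \<le> 1/2"
  shows "norm (Arcsin z - Arcsin w) \<le> 2 * norm (z - w)"
proof (rule field_differentiable_bound[of "cball 0 (1/2)" _ "\<lambda>z. inverse (cos (Arcsin z))"])
  fix z :: complex assume z: "z \<in> cball 0 (1/2)"
  then have "\<bar>Re z\<bar> < 1" using abs_Re_le_cmod[of z] by simp
  then show "(Arcsin has_field_derivative inverse (cos (Arcsin z))) (at z within cball 0 (1/2))"
    by (rule has_field_derivative_at_within[OF has_field_derivative_Arcsin])
  have "(norm (cos (Arcsin z)))\<^sup>2 = norm (1 - z\<^sup>2)"
    by (simp add: cos_squared_eq flip: norm_power)
  also have "norm (1 - z\<^sup>2) \<ge> 1 - (1/2)\<^sup>2"
  proof -
    have "norm (z\<^sup>2) \<le> (1/2)\<^sup>2" unfolding norm_power using z by (intro power_mono) auto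
    then show ?thesis using norm_triangle_ineq2[of 1 "z\<^sup>2"] unfolding norm_one by linarith
  qed
  finally have "(1/2)\<^sup>2 \<le> (norm (cos (Arcsin z)))\<^sup>2" by (simp add: power2_eq_square)
  then have "1/2 \<le> norm (cos (Arcsin z))" by (rule power2_le_imp_le) simp
  then show "norm (inverse (cos (Arcsin z))) \<le> 2"
    using le_imp_inverse_le[of "1/2" "norm (cos (Arcsin z))"] by (simp add: norm_inverse)
qed (use assms in auto)

lemma norm_Arcsin_le:
  assumes "norm z \<le> 1/2"
  shows "norm (Arcsin z) \<le> 2 * norm z"
  using norm_Arcsin_diff_le[OF assms, of 0] by simp

text \<open>Reads the logarithm of the resonance equation as an angle. With
  \<open>u = Arcsin (- i \<kappa>)\<close> the equation becomes \<open>K a = b a + u\<close>, and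
  both sine and cosine of \<open>u\<close> are algebraic in \<open>\<kappa>\<close>.\<close>

lemma Arcsin_minus_i_times: "Arcsin (- \<i> * w) = - \<i> * Ln (w + csqrt (w\<^sup>2 + 1))"
  by (simp add: Arcsin_def power_mult_distrib add.commute)

lemma resonance_eq_Arcsin:
  "resonance_eq a lam n \<kappa> \<longleftrightarrow>
     \<kappa> = of_real (real n * pi / (2 * (a * sqrt (2 * lam)))) + Arcsin (- \<i> * \<kappa>) / of_real (a * sqrt (2 * lam))"
  unfolding resonance_eq_def Arcsin_minus_i_times by (simp add: mult.assoc)

text \<open>With \<open>v = csqrt (w^2 + 1)\<close> the exponential of \<open>i u\<close> is
  \<open>w + v\<close>, and its inverse is \<open>v - w\<close> because
  \<open>(v + w)(v - w) = 1\<close>; their mean is \<open>v\<close>.\<close>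

lemma cos_Arcsin_minus_i_times: "cos (Arcsin (- \<i> * w)) = csqrt (w\<^sup>2 + 1)"
proof -
  define v where "v = csqrt (w\<^sup>2 + 1)"
  have "v\<^sup>2 = w\<^sup>2 + 1" by (simp add: v_def)
  then have prod: "(v + w) * (v - w) = 1" by (simp add: power2_eq_square algebra_simps)
  then have nz: "w + v \<noteq> 0" by (auto simp: add.commute)
  have "exp (\<i> * Arcsin (- \<i> * w)) = w + v"
    unfolding Arcsin_minus_i_times v_def[symmetric] using nz by simp
  moreover have "exp (- (\<i> * Arcsin (- \<i> * w))) = v - w"
    unfolding exp_minus calculation using prod by (simp add: inverse_unique add.commute)
  ultimately show ?thesis
    by (simp add: cos_exp_eq v_def del: mult_minus_left)
qed

lemma csqrt_one_plus_square_quadrant: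
  assumes "0 < Re w" "Im w < 0"
  shows "0 < Re (csqrt (w\<^sup>2 + 1))" "Im (csqrt (w\<^sup>2 + 1)) < 0"
proof -
  have "2 * (Re (csqrt (w\<^sup>2 + 1)) * Im (csqrt (w\<^sup>2 + 1))) = Im ((csqrt (w\<^sup>2 + 1))\<^sup>2)"
    by (simp only: Im_power2 mult.assoc)
  also have "\<dots> = 2 * (Re w * Im w)" by (simp add: Im_power2)
  also have "\<dots> < 0" using assms by (simp add: mult_pos_neg)
  finally have "Re (csqrt (w\<^sup>2 + 1)) * Im (csqrt (w\<^sup>2 + 1)) < 0" by (simp add: mult.commute)
  then show "0 < Re (csqrt (w\<^sup>2 + 1))" "Im (csqrt (w\<^sup>2 + 1)) < 0"
    using Re_csqrt[of "w\<^sup>2 + 1"] by (auto simp: mult_less_0_iff)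
qed

section \<open>Existence, uniqueness and location of the fixed point\<close>

lemma Re_csqrt_one_plus_ge:
  assumes "norm w \<le> 1"
  shows "1 - norm w \<le> Re (csqrt (1 + w))"
proof (rule power2_le_imp_le)
  have "(1 - norm w)\<^sup>2 \<le> (1 - norm w) * 1"
    unfolding power2_eq_square using assms by (intro mult_left_mono) auto
  also have "\<dots> \<le> Re ((csqrt (1 + w))\<^sup>2)" using abs_Re_le_cmod[of w] by simp
  also have "\<dots> \<le> (Re (csqrt (1 + w)))\<^sup>2" by (simp only: Re_power2) simp
  finally show "(1 - norm w)\<^sup>2 \<le> (Re (csqrt (1 + w)))\<^sup>2" .
qed (rule Re_csqrt)

text \<open>On the ball of radius \<open>2 * \<beta> \<le> 1/8\<close> the Lipschitz constant 2 of
  \<open>Arcsin\<close> and \<open>\<alpha> \<ge> 8\<close> give the contraction factor 1/4, and the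
  image has norm at most \<open>\<beta> + \<beta> / 2\<close>.\<close>

lemma resonance_exists:
  fixes \<alpha> \<beta> :: real
  assumes "8 \<le> \<alpha>" "0 < \<beta>" "\<beta> \<le> 1/16"
  obtains \<kappa> where "\<kappa> = of_real \<beta> + Arcsin (- \<i> * \<kappa>) / of_real \<alpha>" "norm \<kappa> \<le> 2 * \<beta>"
    "\<And>\<kappa>'. norm \<kappa>' \<le> 2 * \<beta> \<Longrightarrow> \<kappa>' = of_real \<beta> + Arcsin (- \<i> * \<kappa>') / of_real \<alpha> \<Longrightarrow> \<kappa>' = \<kappa>"
proof -
  let ?T = "\<lambda>\<kappa>. of_real \<beta> + Arcsin (- \<i> * \<kappa>) / of_real \<alpha>"
  have "\<exists>!\<kappa>\<in>cball 0 (2 * \<beta>). ?T \<kappa> = \<kappa>"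
  proof (rule Banach_fix[where c = "1/4"])
    show "?T ` cball 0 (2 * \<beta>) \<subseteq> cball 0 (2 * \<beta>)"
    proof safe
      fix \<kappa> :: complex assume "\<kappa> \<in> cball 0 (2 * \<beta>)"
      then have k: "norm \<kappa> \<le> 2 * \<beta>" by simp
      then have "norm (Arcsin (- \<i> * \<kappa>)) \<le> 2 * norm \<kappa>"
        using norm_Arcsin_le[of "- \<i> * \<kappa>"] assms by (simp add: norm_mult)
      then have "norm (Arcsin (- \<i> * \<kappa>)) / \<alpha> \<le> (4 * \<beta>) / 8"
        using assms k by (intro frac_le) auto
      moreover have "norm (?T \<kappa>) \<le> norm (complex_of_real \<beta>) + norm (Arcsin (- \<i> * \<kappa>) / of_real \<alpha>)"
        by (rule norm_triangle_ineq)
      moreover have "norm (complex_of_real \<beta>) = \<beta>"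
        "norm (Arcsin (- \<i> * \<kappa>) / of_real \<alpha>) = norm (Arcsin (- \<i> * \<kappa>)) / \<alpha>"
        using assms by (simp_all add: norm_divide)
      ultimately show "?T \<kappa> \<in> cball 0 (2 * \<beta>)"
        unfolding mem_cball_0 using assms(2) by linarith
    qed
    fix x y :: complex assume "x \<in> cball 0 (2 * \<beta>)" "y \<in> cball 0 (2 * \<beta>)"
    then have "norm (Arcsin (- \<i> * x) - Arcsin (- \<i> * y)) \<le> 2 * norm (- \<i> * x - - \<i> * y)"
      using assms by (intro norm_Arcsin_diff_le) (auto simp: norm_mult)
    also have "- \<i> * x - - \<i> * y = - \<i> * (x - y)" by (simp add: algebra_simps)
    finally have "norm (Arcsin (- \<i> * x) - Arcsin (- \<i> * y)) / \<alpha> \<le> (2 * norm (x - y)) / 8"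
      using assms by (intro frac_le) (auto simp: norm_mult)
    then show "dist (?T x) (?T y) \<le> 1/4 * dist x y"
      using assms by (simp add: dist_norm norm_divide flip: diff_divide_distrib)
  qed (use assms in \<open>auto intro: complete_UNIV simp: complete_eq_closed\<close>)
  then show ?thesis using that by (metis mem_cball_0)
qed

text \<open>Brings every solution in the fourth quadrant into the ball where the fixed point is
  unique. There \<open>Re u\<close> is the argument of \<open>w\<close>, hence nonpositive, so
  \<open>Re \<kappa> \<le> \<beta>\<close>; and
  \<open>- Im u = ln (norm w) \<le> 2 * norm \<kappa>\<close> bounds the imaginary part by a quarter
  of \<open>norm \<kappa>\<close>.\<close>

lemma resonance_norm_le:
  assumes eq: "\<kappa> = of_real \<beta> + Arcsin (- \<i> * \<kappa>) / of_real \<alpha>"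
    and "8 \<le> \<alpha>" "0 < \<beta>" "0 < Re \<kappa>" "Im \<kappa> < 0"
  shows "norm \<kappa> \<le> 2 * \<beta>"
proof -
  define w where "w = \<kappa> + csqrt (\<kappa>\<^sup>2 + 1)"
  define u where "u = Arcsin (- \<i> * \<kappa>)"
  have w: "0 < Re w" "Im w < 0" using csqrt_one_plus_square_quadrant[OF assms(4,5)] assms(4,5)
    by (auto simp: w_def)
  then have "w \<noteq> 0" by auto
  have u: "u = - \<i> * Ln w" by (simp only: u_def w_def Arcsin_minus_i_times)
  have equ: "\<kappa> = of_real \<beta> + u / of_real \<alpha>" using eq unfolding u_def .
  have Re: "Re \<kappa> = \<beta> + Re u / \<alpha>" and Im: "Im \<kappa> = Im u / \<alpha>"
    using arg_cong[OF equ, of Re] arg_cong[OF equ, of Im] by simp_all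
  have "Re u \<le> 0"
    using Im_Ln_pos_le[OF \<open>w \<noteq> 0\<close>] Im_Ln_le_pi[OF \<open>w \<noteq> 0\<close>] w by (simp add: u)
  then have "Re \<kappa> \<le> \<beta>" using Re assms(2) by (simp add: divide_nonpos_pos)
  have "- Im u = ln (norm w)" using \<open>w \<noteq> 0\<close> by (simp add: u)
  also have "\<dots> \<le> norm w - 1" using \<open>w \<noteq> 0\<close> by (intro ln_le_minus_one) simp
  also have "norm w \<le> norm \<kappa> + sqrt (norm (\<kappa>\<^sup>2 + 1))"
    unfolding w_def using norm_triangle_ineq[of \<kappa> "csqrt (\<kappa>\<^sup>2 + 1)"] by (simp only: norm_csqrt)
  also have "sqrt (norm (\<kappa>\<^sup>2 + 1)) \<le> norm \<kappa> + 1"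
  proof (rule real_le_lsqrt)
    have "norm (\<kappa>\<^sup>2 + 1) \<le> (norm \<kappa>)\<^sup>2 + 1"
      using norm_triangle_ineq[of "\<kappa>\<^sup>2" 1] by (simp add: norm_power)
    also have "\<dots> \<le> (norm \<kappa> + 1)\<^sup>2" by (simp add: power2_eq_square algebra_simps)
    finally show "norm (\<kappa>\<^sup>2 + 1) \<le> (norm \<kappa> + 1)\<^sup>2" .
  qed auto
  finally have "- Im u \<le> 2 * norm \<kappa>" by simp
  then have "(- Im u) / \<alpha> \<le> (2 * norm \<kappa>) / 8" using assms(2) by (intro frac_le) auto
  then show ?thesis
    using cmod_le[of \<kappa>] \<open>Re \<kappa> \<le> \<beta>\<close> Im assms(4,5) norm_ge_zero[of \<kappa>] by simp
qed

text \<open>The sign of \<open>Im \<kappa>\<close> comes from \<open>norm w > 1\<close>: the real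
  part of \<open>\<kappa>\<close> exceeds the second-order loss in the square root. The quantitative
  form \<open>- Im u \<ge> \<beta> / 8\<close> later keeps \<open>K\<close> away from
  \<open>b\<close>.\<close>

lemma resonance_quadrant:
  assumes eq: "\<kappa> = of_real \<beta> + Arcsin (- \<i> * \<kappa>) / of_real \<alpha>"
    and "8 \<le> \<alpha>" "0 < \<beta>" "\<beta> \<le> 1/16" "norm \<kappa> \<le> 2 * \<beta>"
  shows "\<beta> / 2 \<le> Re \<kappa>" "Im \<kappa> < 0" "\<beta> / 8 \<le> norm (Arcsin (- \<i> * \<kappa>))"
proof -
  define w where "w = \<kappa> + csqrt (1 + \<kappa>\<^sup>2)"
  define u where "u = Arcsin (- \<i> * \<kappa>)"
  have equ: "\<kappa> = of_real \<beta> + u / of_real \<alpha>" using eq unfolding u_def .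
  have Re: "Re \<kappa> = \<beta> + Re u / \<alpha>" and Im: "Im \<kappa> = Im u / \<alpha>"
    using arg_cong[OF equ, of Re] arg_cong[OF equ, of Im] by simp_all
  have "norm u \<le> 4 * \<beta>"
    using norm_Arcsin_le[of "- \<i> * \<kappa>"] assms by (simp add: norm_mult u_def)
  then have "\<bar>Re u\<bar> \<le> 4 * \<beta>" using abs_Re_le_cmod[of u] by linarith
  then have "\<bar>Re u\<bar> / \<alpha> \<le> (4 * \<beta>) / 8" using assms by (intro frac_le) auto
  moreover have "- (\<bar>Re u\<bar> / \<alpha>) \<le> Re u / \<alpha>" using assms(2) by (simp add: field_simps)
  ultimately show Rk: "\<beta> / 2 \<le> Re \<kappa>" using Re by linarith
  have k2: "norm (\<kappa>\<^sup>2) \<le> \<beta> / 4"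
  proof -
    have "norm (\<kappa>\<^sup>2) \<le> (2 * \<beta>)\<^sup>2" unfolding norm_power using assms by (intro power_mono) auto
    also have "\<dots> = 4 * \<beta> * \<beta>" by (simp add: power2_eq_square)
    also have "\<dots> \<le> 4 * \<beta> * (1/16)" using assms by (intro mult_left_mono) auto
    finally show ?thesis by simp
  qed
  then have "1 + \<beta> / 4 \<le> Re w"
    using Re_csqrt_one_plus_ge[of "\<kappa>\<^sup>2"] Rk assms(4) by (simp add: w_def)
  then have w: "1 + \<beta> / 4 \<le> norm w" using complex_Re_le_cmod[of w] by linarith
  then have "w \<noteq> 0" using assms(3) by auto
  have "\<beta> / 8 \<le> \<beta> / 4 - (\<beta> / 4)\<^sup>2"
    using assms mult_left_mono[of \<beta> "1/16" \<beta>] by (simp add: power2_eq_square)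
  also have "\<dots> \<le> ln (1 + \<beta> / 4)"
    using assms by (intro ln_one_plus_pos_lower_bound) auto
  also have "\<dots> \<le> ln (norm w)" using w assms(3) by (subst ln_le_cancel_iff) linarith+
  also have "\<dots> = - Im u"
    unfolding u_def Arcsin_minus_i_times using \<open>w \<noteq> 0\<close> by (simp add: w_def add.commute)
  finally have u: "\<beta> / 8 \<le> - Im u" .
  then show "Im \<kappa> < 0" using Im assms by (simp add: divide_neg_pos)
  show "\<beta> / 8 \<le> norm (Arcsin (- \<i> * \<kappa>))"
    using u abs_Im_le_cmod[of u] unfolding u_def[symmetric] by linarith
qed

text \<open>Resolves the definite description in \<open>zres\<close>, with \<open>\<kappa>\<close>
  as coordinate: \<open>z = L csqrt (\<kappa>^2 + 1)\<close> and
  \<open>ktilde lam z = L \<kappa>\<close>.\<close>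

lemma zres_obtains:
  fixes a lam :: real and n :: nat
  defines "L \<equiv> sqrt (2 * lam)"
  defines "\<beta> \<equiv> real n * pi / (2 * (a * L))"
  assumes "0 < a" "0 < lam" "1 \<le> n" "8 * real n * pi \<le> a * L"
  obtains \<kappa> where "zres a lam n = of_real L * csqrt (\<kappa>\<^sup>2 + 1)"
    "ktilde lam (zres a lam n) = of_real L * \<kappa>"
    "\<kappa> = of_real \<beta> + Arcsin (- \<i> * \<kappa>) / of_real (a * L)"
    "norm \<kappa> \<le> 2 * \<beta>" "\<beta> \<le> 1/16" "0 < \<beta>" "8 \<le> a * L"
proof -
  have L: "0 < L" using assms by (simp add: L_def)
  have L2: "(of_real L)\<^sup>2 = (2 * of_real lam :: complex)"
    using assms(4) by (simp add: L_def flip: of_real_power)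
  \<comment> \<open>The single largeness condition gives both hypotheses of the contraction,
    \<open>8 \<le> a L\<close> and \<open>\<beta> \<le> 1/16\<close>.\<close>
  have "8 * 1 * 1 \<le> 8 * real n * pi"
    using assms(5) pi_gt3 by (intro mult_mono) auto
  with assms have \<alpha>: "8 \<le> a * L" by linarith
  have \<beta>: "0 < \<beta>" "\<beta> \<le> 1/16"
    using assms L by (auto simp: \<beta>_def field_simps)
  obtain \<kappa> where eq: "\<kappa> = of_real \<beta> + Arcsin (- \<i> * \<kappa>) / of_real (a * L)"
    and norm: "norm \<kappa> \<le> 2 * \<beta>"
    and uniq: "\<And>\<kappa>'. norm \<kappa>' \<le> 2 * \<beta> \<Longrightarrow> \<kappa>' = of_real \<beta> + Arcsin (- \<i> * \<kappa>') / of_real (a * L) \<Longrightarrow> \<kappa>' = \<kappa>"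
    using resonance_exists[OF \<alpha> \<beta>] by metis
  have quad: "0 < Re \<kappa>" "Im \<kappa> < 0"
    using resonance_quadrant[OF eq \<alpha> \<beta> norm] \<beta> by auto
  define z where "z = of_real L * csqrt (\<kappa>\<^sup>2 + 1)"
  have Kz: "ktilde lam z = of_real L * \<kappa>"
    unfolding ktilde_def
  proof (rule csqrt_unique)
    show "(of_real L * \<kappa>)\<^sup>2 = z\<^sup>2 - 2 * of_real lam"
      by (simp add: z_def power_mult_distrib L2 algebra_simps)
  qed (use quad L in auto)
  have "zres a lam n = z"
    unfolding zres_def
  proof (rule the_equality)
    show "Re z > 0 \<and> Im z < 0 \<and> resonance_eq a lam n (ktilde lam z / of_real (sqrt (2 * lam)))"
      unfolding resonance_eq_Arcsin Kz using L csqrt_one_plus_square_quadrant[OF quad] eq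
      by (simp add: z_def mult_pos_neg \<beta>_def flip: L_def del: mult_minus_left of_real_mult of_real_divide)
  next
    fix y assume y: "Re y > 0 \<and> Im y < 0 \<and> resonance_eq a lam n (ktilde lam y / of_real (sqrt (2 * lam)))"
    \<comment> \<open>For a competitor \<open>y\<close>, the product of real and imaginary part of
      its root has the sign of that of \<open>y\<close>. So \<open>q\<close> lies in the fourth
      quadrant, equals \<open>\<kappa>\<close>, and determines \<open>y\<close>.\<close>
    define q where "q = ktilde lam y / of_real L"
    have "(of_real L * q)\<^sup>2 = y\<^sup>2 - (of_real L)\<^sup>2"
      using L by (simp add: q_def ktilde_def L2)
    then have q2: "of_real L * of_real L * (q\<^sup>2 + 1) = y\<^sup>2"
      by (simp add: power_mult_distrib algebra_simps power2_eq_square)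
    have "2 * (Re (ktilde lam y) * Im (ktilde lam y)) = Im ((ktilde lam y)\<^sup>2)"
      by (simp only: Im_power2 mult.assoc)
    also have "\<dots> = 2 * (Re y * Im y)" by (simp add: ktilde_def Im_power2)
    also have "\<dots> < 0" using y by (simp add: mult_pos_neg)
    finally have "Re (ktilde lam y) * Im (ktilde lam y) < 0" by (simp add: mult.commute)
    then have "0 < Re (ktilde lam y)" "Im (ktilde lam y) < 0"
      using Re_csqrt[of "y\<^sup>2 - 2 * of_real lam"]
      by (auto simp: ktilde_def mult_less_0_iff)
    then have q: "0 < Re q" "Im q < 0"
      using L by (auto simp: q_def divide_neg_pos)
    have qeq: "q = of_real \<beta> + Arcsin (- \<i> * q) / of_real (a * L)"
      using y unfolding resonance_eq_Arcsin q_def \<beta>_def L_def by blast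
    have "q = \<kappa>" by (intro uniq qeq resonance_norm_le[OF qeq \<alpha> \<beta>(1) q])
    have "csqrt (q\<^sup>2 + 1) = y / of_real L"
      using q2 y L by (intro csqrt_unique) (auto simp: power_divide power2_eq_square field_simps)
    then show "y = z" using L \<open>q = \<kappa>\<close> by (simp add: z_def)
  qed
  then show ?thesis using that z_def Kz eq norm \<beta> \<alpha> by blast
qed

subsection \<open>Residue and remainder\<close>

lemma cnj_ktilde_of_real: "cnj (ktilde lam (of_real k)) = ktilde lam (of_real k) \<or> cnj (ktilde lam (of_real k)) = - ktilde lam (of_real k)"
proof -
  have sq: "(ktilde lam (of_real k))\<^sup>2 = of_real (k\<^sup>2 - 2 * lam)" by (simp add: ktilde_def)
  have "(cnj (ktilde lam (of_real k)))\<^sup>2 = (ktilde lam (of_real k))\<^sup>2"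
    unfolding complex_cnj_power[symmetric] sq by (rule complex_cnj_complex_of_real)
  then show ?thesis by (simp add: power2_eq_iff)
qed

lemma cnj_cos_ktilde_of_real:
  "cnj (cos (ktilde lam (of_real k) * of_real x)) = cos (ktilde lam (of_real k) * of_real x)"
  using cnj_ktilde_of_real[of lam k] by (auto simp: cnj_cos)

text \<open>On the real axis conjugating \<open>F\<close> gives \<open>Fbar\<close>, that is
  \<open>jost\<close> divided by \<open>k\<close>; this replaces a conjugate by a function that
  continues holomorphically into the sector.\<close>

lemma cnj_F_of_real:
  assumes "k \<noteq> 0"
  shows "cnj (F a lam (of_real k)) = jost a (of_real k) (ktilde_low lam (of_real k)) / of_real k"
proof -
  have "cnj (ktilde lam (of_real k) * sin (ktilde lam (of_real k) * of_real a))
      = ktilde lam (of_real k) * sin (ktilde lam (of_real k) * of_real a)"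
    using cnj_ktilde_of_real[of lam k] by (auto simp: cnj_sin)
  moreover have "F a lam (of_real k) = cos (ktilde lam (of_real k) * of_real a)
      - \<i> * (ktilde lam (of_real k) * sin (ktilde lam (of_real k) * of_real a)) / of_real k"
    by (simp add: F_def)
  ultimately have "cnj (F a lam (of_real k)) = cos (ktilde lam (of_real k) * of_real a)
      + \<i> * (ktilde lam (of_real k) * sin (ktilde lam (of_real k) * of_real a)) / of_real k"
    by (simp only: complex_cnj_diff complex_cnj_divide complex_cnj_mult[of \<i>] cnj_cos_ktilde_of_real
        complex_cnj_i complex_cnj_complex_of_real) simp
  then show ?thesis
    using assms unfolding cos_sin_ktilde_low by (simp add: jost_def field_simps)
qed

text \<open>The antiderivative is the Wronskian of the two cosines divided by the difference of the
  squared frequencies, up to sign. The Dirichlet condition \<open>cos (b a) = 0\<close> removes one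
  of its two boundary terms.\<close>

lemma has_integral_cos_mult_cos:
  fixes K :: complex and a b :: real
  assumes "0 \<le> a" "cos (b * a) = 0" "K\<^sup>2 \<noteq> of_real (b\<^sup>2)"
  shows "((\<lambda>x. of_real (cos (b * x)) * cos (K * of_real x)) has_integral
     2 * of_real (b * sin (b * a)) * cos (K * of_real a) / (of_real (b\<^sup>2) - K\<^sup>2)) {-a..a}"
proof -
  define B where "B = complex_of_real b"
  define G where "G w = (B * sin (B * w) * cos (K * w) - K * cos (B * w) * sin (K * w)) / (B\<^sup>2 - K\<^sup>2)" for w
  have ne: "B\<^sup>2 - K\<^sup>2 \<noteq> 0" using assms(3) by (simp add: B_def)
  have "((\<lambda>w. B * sin (B * w) * cos (K * w) - K * cos (B * w) * sin (K * w)) has_field_derivative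
      (B\<^sup>2 - K\<^sup>2) * (cos (B * w) * cos (K * w))) (at w)" for w
    by (auto intro!: derivative_eq_intros simp: algebra_simps power2_eq_square)
  from DERIV_cdivide[OF this, of "B\<^sup>2 - K\<^sup>2"]
  have der: "(G has_field_derivative cos (B * w) * cos (K * w)) (at w)" for w
    using ne by (simp add: G_def[abs_def])
  have "((\<lambda>x. cos (B * of_real x) * cos (K * of_real x)) has_integral G (of_real a) - G (of_real (- a))) {-a..a}"
    by (rule fundamental_theorem_of_calculus)
       (use assms(1) in \<open>auto intro: has_vector_derivative_real_field der\<close>)
  moreover have cosB: "cos (B * of_real x) = of_real (cos (b * x))" for x
    by (simp add: B_def flip: cos_of_real)
  have sinB: "sin (B * of_real x) = of_real (sin (b * x))" for x
    by (simp add: B_def flip: sin_of_real)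
  have "G (of_real a) - G (of_real (- a)) =
      2 * of_real (b * sin (b * a)) * cos (K * of_real a) / (of_real (b\<^sup>2) - K\<^sup>2)"
    using assms(2) by (simp add: G_def cosB sinB diff_divide_distrib[symmetric]) (simp add: B_def)
  ultimately show ?thesis by (simp add: cosB)
qed

lemma cos_odd_half_pi:
  assumes "0 < a" "odd n"
  shows "cos (real n * pi / (2 * a) * a) = 0"
proof -
  have "real n * pi / (2 * a) * a = real n * (pi / 2)" using assms by simp
  then show ?thesis using assms by (auto simp: cos_zero_iff)
qed

text \<open>The phase \<open>exp (i k a)\<close> stands apart because the phase of
  \<open>eta\<close> cancels it. Only the single point where \<open>K^2 = b^2\<close> is left
  out.\<close>

lemma psi_hat_eq:
  fixes a lam k :: real and n :: nat
  defines "b \<equiv> real n * pi / (2 * a)"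
  assumes "0 < a" "0 < k" "cos (b * a) = 0" "k\<^sup>2 \<noteq> b\<^sup>2 + 2 * lam"
  shows "psi_hat a lam n k = exp (\<i> * of_real k * of_real a) *
    (2 * of_real (b * sin (b * a)) / of_real (sqrt pi)) * amplitude a lam b (of_real k)"
proof -
  define K where "K = ktilde lam (of_real k)"
  define E where "E = exp (\<i> * of_real k * of_real a) / (of_real (sqrt pi) * cnj (F a lam (of_real k)))"
  have K2: "K\<^sup>2 = of_real (k\<^sup>2 - 2 * lam)" "(ktilde_low lam (of_real k))\<^sup>2 = K\<^sup>2"
    by (simp_all add: K_def ktilde_def ktilde_low_square)
  have ne: "K\<^sup>2 \<noteq> of_real (b\<^sup>2)" unfolding K2 of_real_eq_iff using assms(5) by auto
  have ne': "(ktilde_low lam (of_real k))\<^sup>2 \<noteq> of_real (b\<^sup>2)" using ne K2(2) by simp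
  have cosK: "cos (K * of_real a) = cos (ktilde_low lam (of_real k) * of_real a)"
    unfolding K_def by (rule cos_sin_ktilde_low(1))
  have "psi a n x * cnj (phi a lam k x) = indicator {-a..a} x *\<^sub>R (E * (of_real (cos (b * x)) * cos (K * of_real x)))" for x
  proof (cases "x \<in> {-a..a}")
    case True
    then have "\<bar>x\<bar> \<le> a" by auto
    then have "cnj (phi a lam k x) = E * cos (K * of_real x)"
      by (simp add: phi_def K_def E_def cnj_cos_ktilde_of_real exp_cnj)
    then show ?thesis using True by (simp add: psi_def chi_def b_def)
  qed (simp add: psi_def chi_def)
  then have "psi_hat a lam n k = (LINT x:{-a..a}|lborel. E * (of_real (cos (b * x)) * cos (K * of_real x)))"
    by (simp only: psi_hat_def set_lebesgue_integral_def)
  also have "\<dots> = integral {-a..a} (\<lambda>x. E * (of_real (cos (b * x)) * cos (K * of_real x)))"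
    by (intro set_borel_integral_eq_integral borel_integrable_atLeastAtMost' continuous_intros)
  also have "\<dots> = E * (2 * of_real (b * sin (b * a)) * cos (K * of_real a) / (of_real (b\<^sup>2) - K\<^sup>2))"
    using assms(2,4) ne
    by (intro integral_unique has_integral_mult_right has_integral_cos_mult_cos) auto
  also have "\<dots> = exp (\<i> * of_real k * of_real a) *
    (2 * of_real (b * sin (b * a)) / of_real (sqrt pi)) * amplitude a lam b (of_real k)"
    using assms(3) ne' unfolding cosK amplitude_eq[OF assms(4) ne'] E_def cnj_F_of_real[OF less_imp_neq[OF assms(3), symmetric]]
    by (simp add: K2(2) mult_ac)
  finally show ?thesis .
qed

section \<open>Derivative and residue at a zero of \<open>F\<close>\<close>

lemma F_has_field_derivative:
  fixes k :: complex and a lam :: real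
  defines "K \<equiv> ktilde lam k"
  assumes "Re k > 0" "Im k < 0" "F a lam k = 0"
  shows "(F a lam has_field_derivative
    - (2 * of_real lam * (of_real a * k + \<i>) * sin (K * of_real a) / (K * k\<^sup>2))) (at k)"
proof -
  have K2: "K\<^sup>2 = k\<^sup>2 - 2 * of_real lam" by (simp add: K_def ktilde_def)
  have im: "Im (k\<^sup>2 - 2 * of_real lam) < 0" using assms by (simp add: Im_power2 mult_pos_neg)
  then have "k\<^sup>2 - 2 * of_real lam \<notin> \<real>\<^sub>\<le>\<^sub>0" by (auto simp: complex_nonpos_Reals_iff)
  then have dK: "(ktilde lam has_field_derivative k / K) (at k)"
    unfolding ktilde_def K_def by (auto intro!: derivative_eq_intros)
  have "K \<noteq> 0" using im K2 by auto
  have "k \<noteq> 0" using assms by auto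
  let ?c = "cos (K * of_real a)" and ?s = "sin (K * of_real a)"
  have dc: "((\<lambda>k. cos (ktilde lam k * of_real a)) has_field_derivative - ?s * (k / K * of_real a)) (at k)"
    and ds: "((\<lambda>k. sin (ktilde lam k * of_real a)) has_field_derivative ?c * (k / K * of_real a)) (at k)"
    by (auto intro!: derivative_eq_intros dK simp: K_def)
  have dq: "((\<lambda>k. ktilde lam k / k) has_field_derivative (k / K * k - K) / (k * k)) (at k)"
    using \<open>k \<noteq> 0\<close> by (auto intro!: derivative_eq_intros dK simp: K_def)
  have "(F a lam has_field_derivative
      - ?s * (k / K * of_real a) - \<i> * ((k / K * k - K) / (k * k) * ?s + ?c * (k / K * of_real a) * (K / k))) (at k)"
    using DERIV_diff[OF dc DERIV_cmult[OF DERIV_mult[OF dq ds], of \<i>]]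
    unfolding F_def[abs_def] K_def[symmetric] mult.assoc .
  \<comment> \<open>The equation \<open>F = 0\<close> eliminates the cosine, and
    \<open>K^2 - k^2 = - 2 lam\<close> then collapses the derivative to one term.\<close>
  moreover have c: "?c = \<i> * (K / k) * ?s" using assms by (simp add: F_def K_def)
  have "- ?s * (k / K * of_real a) - \<i> * ((k / K * k - K) / (k * k) * ?s + ?c * (k / K * of_real a) * (K / k))
      = ((K\<^sup>2 - k\<^sup>2) * (of_real a * k + \<i>) * ?s / (K * k\<^sup>2))"
    unfolding c using \<open>k \<noteq> 0\<close> \<open>K \<noteq> 0\<close> by (simp add: divide_simps power2_eq_square) (simp add: algebra_simps)
  ultimately show ?thesis by (simp add: K2)
qed

lemma residue_inverse_F:
  assumes "Re z > 0" "Im z < 0" "F a lam z = 0" "(F a lam has_field_derivative D) (at z)" "D \<noteq> 0"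
  shows "residue (\<lambda>w. 1 / (of_real (sqrt pi) * F a lam w)) z = 1 / (of_real (sqrt pi) * D)"
proof (rule residue_simple_pole_deriv)
  let ?U = "{w. Re w > 0} \<inter> {w. Im w < 0}"
  show "open ?U" by (intro open_Int open_halfspace_Re_gt open_halfspace_Im_lt)
  show "connected ?U" by (intro convex_connected convex_Int convex_halfspace_Re_gt convex_halfspace_Im_lt)
  show "(\<lambda>w. of_real (sqrt pi) * F a lam w) holomorphic_on ?U"
    unfolding F_def ktilde_def
    by (intro holomorphic_intros) (auto simp: complex_nonpos_Reals_iff Im_power2 not_le mult_pos_neg mult_neg_pos)
  show "((\<lambda>w. of_real (sqrt pi) * F a lam w) has_field_derivative of_real (sqrt pi) * D) (at z)"
    using assms(4) by (rule DERIV_cmult)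
qed (use assms in auto)


text \<open>With \<open>z = L \<mu>\<close> and \<open>K a = b a + u\<close> one gets
  \<open>cos (K a) = i s \<kappa>\<close> and \<open>sin (K a) = s \<mu>\<close> for a sign
  \<open>s\<close>, so every quantity at the resonance becomes algebraic in \<open>\<kappa>\<close>
  and \<open>\<mu>\<close>.\<close>

lemma resonance_facts:
  fixes a lam :: real and n :: nat
  defines "L \<equiv> sqrt (2 * lam)" and "b \<equiv> real n * pi / (2 * a)"
  defines "z \<equiv> zres a lam n"
  assumes "0 < a" "0 < lam" "1 \<le> n" "odd n" "8 * real n * pi \<le> a * L"
  shows "0 < - Im z" "- Im z < Re z" "L / 2 \<le> Re z + Im z"
    and "amplitude a lam b z = 1 / (2 * (of_real (b\<^sup>2) - (ktilde lam z)\<^sup>2))"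
    and "b\<^sup>2 / (8 * a * L) \<le> norm (of_real (b\<^sup>2) - (ktilde lam z)\<^sup>2)"
    and "residue (\<lambda>w. 1 / (of_real (sqrt pi) * F a lam w)) z \<noteq> 0"
    and "norm (residue (\<lambda>w. 1 / (of_real (sqrt pi) * F a lam w)) z) \<le> 4 * b / (a * L * sqrt pi)"
proof -
  define \<beta> where "\<beta> = b / L"
  obtain \<kappa> where z: "z = of_real L * csqrt (\<kappa>\<^sup>2 + 1)"
    and Kz: "ktilde lam z = of_real L * \<kappa>"
    and eq: "\<kappa> = of_real \<beta> + Arcsin (- \<i> * \<kappa>) / of_real (a * L)"
    and norm: "norm \<kappa> \<le> 2 * \<beta>" and \<beta>: "\<beta> \<le> 1/16" "0 < \<beta>" and aL: "8 \<le> a * L"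
  proof -
    have "\<beta> = real n * pi / (2 * (a * L))" by (simp add: \<beta>_def b_def)
    then show thesis
      using that zres_obtains[OF assms(4,5,6) assms(8)[unfolded L_def]] unfolding L_def z_def by metis
  qed
  define u where "u = Arcsin (- \<i> * \<kappa>)"
  define \<mu> where "\<mu> = csqrt (\<kappa>\<^sup>2 + 1)"
  define s where "s = sin (b * a)"
  have L: "0 < L" using assms by (simp add: L_def)
  have b: "0 < b" using assms by (simp add: b_def)
  have quad: "\<beta> / 2 \<le> Re \<kappa>" "Im \<kappa> < 0" "\<beta> / 8 \<le> norm u"
    using resonance_quadrant[OF eq aL \<beta>(2,1) norm] by (auto simp: u_def)
  then have "0 < Re \<kappa>" using \<beta> by linarith
  have "\<kappa> \<noteq> 0" using quad by auto
  have \<mu>_quad: "0 < Re \<mu>" "Im \<mu> < 0"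
    using csqrt_one_plus_square_quadrant[OF \<open>0 < Re \<kappa>\<close> \<open>Im \<kappa> < 0\<close>] by (auto simp: \<mu>_def)
  have "\<mu> \<noteq> 0" using \<mu>_quad by auto
  have z': "z = of_real L * \<mu>" by (simp add: z \<mu>_def)
  have z_quad: "0 < Re z" "Im z < 0" using \<mu>_quad L by (auto simp: z' mult_pos_neg)
  have "z \<noteq> 0" using z_quad by auto
  have \<mu>1: "norm (\<mu> - 1) \<le> 1/64"
  proof -
    \<comment> \<open>The product is \<open>\<kappa>^2\<close>, of modulus at most 1/64, and the
      second factor has modulus at least 1.\<close>
    have "(\<mu> - 1) * (\<mu> + 1) = \<mu>\<^sup>2 - 1" by (simp add: power2_eq_square algebra_simps)
    also have "\<dots> = \<kappa>\<^sup>2" by (simp add: \<mu>_def)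
    finally have "norm (\<mu> - 1) * norm (\<mu> + 1) = (norm \<kappa>)\<^sup>2"
      by (metis norm_mult norm_power)
    also have "\<dots> \<le> (1/8)\<^sup>2" using norm \<beta> by (intro power_mono) auto
    finally have "norm (\<mu> - 1) * norm (\<mu> + 1) \<le> 1/64" by (simp add: power2_eq_square)
    moreover have "1 \<le> norm (\<mu> + 1)" using complex_Re_le_cmod[of "\<mu> + 1"] \<mu>_quad by simp
    then have "norm (\<mu> - 1) * 1 \<le> norm (\<mu> - 1) * norm (\<mu> + 1)" by (intro mult_left_mono) auto
    ultimately show ?thesis by linarith
  qed
  have \<mu>_Re: "63/64 \<le> Re \<mu>" and \<mu>_Im: "- (1/64) \<le> Im \<mu>"
    using abs_Re_le_cmod[of "\<mu> - 1"] abs_Im_le_cmod[of "\<mu> - 1"] \<mu>1 by simp_all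
  \<comment> \<open>The margin \<open>L / 2\<close> puts \<open>z\<close> strictly inside the sector
    and later separates it from the diagonal.\<close>
  have "L * (1/2) \<le> L * (Re \<mu> + Im \<mu>)" using L \<mu>_Re \<mu>_Im by (intro mult_left_mono) linarith+
  then show half: "L / 2 \<le> Re z + Im z" by (simp add: z' algebra_simps)
  then show "0 < - Im z" "- Im z < Re z" using z_quad L by linarith+

  have cosb: "cos (b * a) = 0"
    unfolding b_def by (rule cos_odd_half_pi[OF assms(4,7)])
  have s2: "s = 1 \<or> s = -1"
    using sin_cos_squared_add[of "b * a"] cosb by (simp add: s_def power2_eq_1_iff)
  have LK: "of_real L * \<kappa> = of_real b + u / of_real a"
    using eq L assms(4) by (subst eq) (simp add: \<beta>_def u_def field_simps)
  then have Ka: "of_real L * \<kappa> * of_real a = of_real (b * a) + u"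
    using assms(4) by (simp add: field_simps)
  have "complex_of_real (cos (b * a)) = 0" "complex_of_real (sin (b * a)) = of_real s"
    using cosb by (simp_all add: s_def)
  then have "cos (complex_of_real (b * a)) = 0" "sin (complex_of_real (b * a)) = of_real s"
    by (simp_all only: cos_of_real sin_of_real)
  moreover have "cos u = \<mu>" "sin u = - \<i> * \<kappa>"
    unfolding u_def \<mu>_def by (rule cos_Arcsin_minus_i_times) (rule sin_Arcsin)
  ultimately have cosK: "cos (ktilde lam z * of_real a) = \<i> * of_real s * \<kappa>"
    and sinK: "sin (ktilde lam z * of_real a) = of_real s * \<mu>"
    unfolding Kz Ka cos_add sin_add by simp_all
  have Fz: "F a lam z = 0"
    unfolding F_def cosK sinK unfolding Kz using L \<open>\<mu> \<noteq> 0\<close> by (simp add: z')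
  have zw: "z \<in> wedge" using \<open>- Im z < Re z\<close> z_quad by (simp add: wedge_def)

  \<comment> \<open>The factor \<open>b - K\<close> is exactly \<open>- u / a\<close>, small but
    bounded below through \<open>u\<close>; the factor \<open>b + K\<close> has real part above
    \<open>b\<close>.\<close>
  have "(of_real b - ktilde lam z) * (of_real b + ktilde lam z) = of_real (b\<^sup>2) - (ktilde lam z)\<^sup>2"
    by (simp add: power2_eq_square algebra_simps)
  moreover have "\<beta> / 8 / a \<le> norm (of_real b - ktilde lam z)"
    using divide_right_mono[OF quad(3), of a] assms(4) by (simp add: Kz LK norm_divide)
  moreover have "b \<le> norm (of_real b + ktilde lam z)"
    using complex_Re_le_cmod[of "of_real b + ktilde lam z"] \<open>0 < Re \<kappa>\<close> L
    by (simp add: Kz) (smt (verit) mult_pos_pos)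
  ultimately have "\<beta> / 8 / a * b \<le> norm (of_real (b\<^sup>2) - (ktilde lam z)\<^sup>2)"
    using \<beta> b assms(4) by (metis norm_mult mult_mono' divide_nonneg_pos less_imp_le zero_less_numeral)
  moreover have "\<beta> / 8 / a * b = b\<^sup>2 / (8 * a * L)" by (simp add: \<beta>_def power2_eq_square)
  ultimately show lower: "b\<^sup>2 / (8 * a * L) \<le> norm (of_real (b\<^sup>2) - (ktilde lam z)\<^sup>2)" by simp

  have low: "ktilde_low lam z = ktilde lam z" by (rule ktilde_low_eq_ktilde[OF zw z_quad])
  have "0 < b\<^sup>2 / (8 * a * L)" using b assms(4) L by simp
  with lower have ne: "(ktilde_low lam z)\<^sup>2 \<noteq> of_real (b\<^sup>2)" unfolding low by auto
  \<comment> \<open>At the zero of \<open>F\<close> the two summands of \<open>jost\<close>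
    coincide; \<open>X\<close> is their common value and also the numerator of the
    amplitude.\<close>
  define X where "X = z * (\<i> * of_real s * \<kappa>)"
  have jost: "jost a z (ktilde lam z) = 2 * X"
    unfolding jost_def cosK sinK unfolding Kz by (simp add: X_def z' algebra_simps)
  have "X \<noteq> 0" using \<open>z \<noteq> 0\<close> \<open>\<kappa> \<noteq> 0\<close> s2 by (auto simp: X_def)
  then show "amplitude a lam b z = 1 / (2 * (of_real (b\<^sup>2) - (ktilde lam z)\<^sup>2))"
    unfolding amplitude_eq[OF cosb ne] unfolding low cosK jost X_def[symmetric] by simp

  \<comment> \<open>Since \<open>a * norm z \<ge> 2\<close>, the summand \<open>i\<close> costs at
    most half of \<open>a * norm z\<close>.\<close>
  have az: "a * norm z / 2 \<le> norm (of_real a * z + \<i>)" "of_real a * z + \<i> \<noteq> 0"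
  proof -
    have "L * (1/2) \<le> L * Re \<mu>" using L \<mu>_Re by (intro mult_left_mono) auto
    also have "\<dots> \<le> norm z" using complex_Re_le_cmod[of z] by (simp add: z')
    finally have "a * (L * (1/2)) \<le> a * norm z" using assms(4) by (intro mult_left_mono) auto
    then have "2 \<le> a * norm z" using aL by simp
    moreover have "a * norm z - 1 \<le> norm (of_real a * z + \<i>)"
      using norm_triangle_ineq4[of "of_real a * z + \<i>" \<i>] assms(4) by (simp add: norm_mult)
    ultimately show "a * norm z / 2 \<le> norm (of_real a * z + \<i>)" "of_real a * z + \<i> \<noteq> 0" by auto
  qed
  define D where "D = - (2 * of_real lam * (of_real a * z + \<i>) * sin (ktilde lam z * of_real a) / (ktilde lam z * z\<^sup>2))"
  have L2: "2 * complex_of_real lam = of_real L * of_real L"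
  proof -
    have "L * L = 2 * lam" using assms(5) by (simp add: L_def)
    then have "complex_of_real (L * L) = of_real (2 * lam)" by (rule arg_cong)
    then show ?thesis by simp
  qed
  have D: "D = - ((of_real a * z + \<i>) * of_real s / (\<kappa> * z))"
    unfolding D_def sinK L2 using L \<open>\<kappa> \<noteq> 0\<close> \<open>\<mu> \<noteq> 0\<close> \<open>z \<noteq> 0\<close> by (simp add: Kz power2_eq_square) (simp add: z')
  have "D \<noteq> 0" using az \<open>\<kappa> \<noteq> 0\<close> \<open>z \<noteq> 0\<close> s2 by (auto simp: D)
  have res: "residue (\<lambda>w. 1 / (of_real (sqrt pi) * F a lam w)) z = 1 / (of_real (sqrt pi) * D)"
    using F_has_field_derivative[OF z_quad Fz] \<open>D \<noteq> 0\<close>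
    by (intro residue_inverse_F z_quad Fz) (auto simp: D_def)
  then show "residue (\<lambda>w. 1 / (of_real (sqrt pi) * F a lam w)) z \<noteq> 0" using \<open>D \<noteq> 0\<close> by simp
  have "norm (1 / D) = norm \<kappa> * norm z / norm (of_real a * z + \<i>)"
    using s2 by (auto simp: D norm_mult norm_divide)
  also have "\<dots> \<le> (2 * \<beta>) * norm z / (a * norm z / 2)"
    using az norm assms(4) \<open>z \<noteq> 0\<close> \<beta> by (intro frac_le mult_right_mono) auto
  also have "\<dots> = 4 * b / (a * L)" using \<open>z \<noteq> 0\<close> by (simp add: \<beta>_def)
  finally have "norm (1 / D) / sqrt pi \<le> 4 * b / (a * L) / sqrt pi"
    by (intro divide_right_mono) auto
  then show "norm (residue (\<lambda>w. 1 / (of_real (sqrt pi) * F a lam w)) z) \<le> 4 * b / (a * L * sqrt pi)"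
    unfolding res by (simp add: norm_divide norm_mult mult.commute)
qed


section \<open>The expansion with explicit constants\<close>

theorem lemma7:
  fixes a :: real and n :: nat
  assumes "a > 0" and "n \<ge> 1" and "odd n"
  shows "\<exists>C Lam :: real. C > 0 \<and> Lam > 0 \<and>
    (\<forall>lam :: real. lam \<ge> Lam \<and> 1 \<le> n \<and> real n < n_lam lam \<longrightarrow>
      (\<exists>(c :: complex) (r :: real \<Rightarrow> complex).
         c \<noteq> 0 \<and>
         (\<forall>t>0. \<forall>x.
            Psi a lam n x t
            = c * chi a x * gamow a lam n x * exp (- \<i> * ((zres a lam n)\<^sup>2 / 2) * of_real t)
              + chi a x * gamow a lam n x * r t) \<and>
         norm c \<le> C \<and>
         (\<forall>t>0. norm (r t) \<le> C * lam powr (-2) * t powr (-1/2))))"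
proof -
  define b where "b = real n * pi / (2 * a)"
  define s where "s = sin (b * a)"
  have b: "0 < b" using assms by (simp add: b_def)
  have cosb: "cos (b * a) = 0" unfolding b_def by (rule cos_odd_half_pi[OF assms(1,3)])
  have s2: "s = 1 \<or> s = -1"
    using sin_cos_squared_add[of "b * a"] cosb by (simp add: s_def power2_eq_1_iff)
  \<comment> \<open>The summand 64 bounds \<open>c\<close> and \<open>16 b^2 / a\<close> the
    remainder; \<open>Lam\<close> ensures \<open>8 n pi \<le> a sqrt (2 lam)\<close>.\<close>
  define C where "C = 64 + 16 * b\<^sup>2 / a"
  define Lam where "Lam = (8 * real n * pi / a)\<^sup>2"
  have C: "64 \<le> C" "16 * b\<^sup>2 / a \<le> C" "0 < C" using assms by (auto simp: C_def add_pos_nonneg)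
  have Lam: "0 < Lam" using assms by (simp add: Lam_def)
  show ?thesis
  proof (rule exI[of _ C], rule exI[of _ Lam], intro conjI C(3) Lam allI impI)
    fix lam :: real assume "Lam \<le> lam \<and> 1 \<le> n \<and> real n < n_lam lam"
    then have lam: "Lam \<le> lam" by simp
    then have lam0: "0 < lam" using Lam by linarith
    define L where "L = sqrt (2 * lam)"
    have L: "0 < L" "L * L = 2 * lam" using lam0 by (simp_all add: L_def)
    have "8 * real n * pi / a \<le> L"
      unfolding L_def using lam lam0 by (intro real_le_rsqrt) (simp add: Lam_def)
    then have aL: "8 * real n * pi \<le> a * sqrt (2 * lam)"
      using assms(1) by (simp add: L_def field_simps)
    define z where "z = zres a lam n"
    define res where "res = residue (\<lambda>w. 1 / (of_real (sqrt pi) * F a lam w)) z"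
    note facts = resonance_facts[OF assms(1) lam0 assms(2,3) aL, folded L_def b_def z_def, folded res_def]
    \<comment> \<open>\<open>A\<close> gathers the factors of \<open>psi_hat\<close> and
      \<open>eta\<close> that do not depend on \<open>k\<close>.\<close>
    define A where "A = res * (2 * of_real (b * s) / of_real (sqrt pi))"
    define c where "c = - (2 * of_real pi * \<i>) * (A * amplitude a lam b z)"
    define J where "J t = (LINT k:{0<..}|lborel. psi_hat a lam n k * eta a lam n k * exp (- \<i> * of_real (k\<^sup>2 / 2) * of_real t))" for t
    \<comment> \<open>With the remainder defined as a difference the expansion is an identity; the
      content lies in its bound.\<close>
    define r where "r t = J t - c * exp (- \<i> * (z\<^sup>2 / 2) * of_real t)" for t
    have norm_A: "norm A = norm res * 2 * b / sqrt pi"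
      using s2 b by (auto simp: A_def norm_mult norm_divide)
    also have "\<dots> \<le> 4 * b / (a * L * sqrt pi) * 2 * b / sqrt pi"
      using facts(7) b by (intro divide_right_mono mult_right_mono) auto
    also have "\<dots> = 8 * b\<^sup>2 / (a * L * pi)"
      by (simp add: power2_eq_square mult.assoc)
    finally have A_le: "norm A \<le> 8 * b\<^sup>2 / (a * L * pi)" .
    have "A \<noteq> 0" using facts(6) s2 b by (auto simp: A_def)
    define d where "d = of_real (b\<^sup>2) - (ktilde lam z)\<^sup>2"
    have d: "b\<^sup>2 / (8 * a * L) \<le> norm d" "amplitude a lam b z = 1 / (2 * d)"
      using facts(4,5) by (simp_all add: d_def)
    have "0 < b\<^sup>2 / (8 * a * L)" using b assms(1) L by simp
    with d(1) have "d \<noteq> 0" by auto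
    have "c \<noteq> 0" using \<open>A \<noteq> 0\<close> \<open>d \<noteq> 0\<close> by (simp add: c_def d(2))
    have "norm c = pi * norm A / norm d"
      by (simp add: c_def d(2) norm_mult norm_divide)
    \<comment> \<open>The bound for \<open>A\<close> is of order \<open>1 / L\<close> and the one
      for \<open>1 / d\<close> of order \<open>L\<close>, so \<open>a\<close>, \<open>b\<close> and
      \<open>L\<close> cancel.\<close>
    also have "\<dots> \<le> pi * (8 * b\<^sup>2 / (a * L * pi)) / (b\<^sup>2 / (8 * a * L))"
      using A_le d(1) \<open>0 < b\<^sup>2 / (8 * a * L)\<close> assms(1) L by (intro frac_le mult_left_mono) auto
    also have "\<dots> = 64" using b assms(1) L by (simp add: field_simps)
    finally have c_le: "norm c \<le> C" using C by linarith

    have J_eq: "J t = A * (LINT k:{0<..}|lborel. amplitude a lam b (of_real k) / (of_real k - z)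
        * exp (- \<i> * of_real (k\<^sup>2 / 2) * of_real t))" for t
    proof -
      have "J t = (LINT k:{0<..}|lborel. A * (amplitude a lam b (of_real k) / (of_real k - z)
        * exp (- \<i> * of_real (k\<^sup>2 / 2) * of_real t)))"
        unfolding J_def set_lebesgue_integral_def
      \<comment> \<open>The formula for \<open>psi_hat\<close> fails to apply only where
        \<open>k^2 = b^2 + 2 lam\<close>, a null set.\<close>
      proof (rule integral_discrete_difference[of "{sqrt (b\<^sup>2 + 2 * lam)}"])
        fix k :: real assume k: "k \<notin> {sqrt (b\<^sup>2 + 2 * lam)}"
        show "indicator {0<..} k *\<^sub>R (psi_hat a lam n k * eta a lam n k * exp (- \<i> * of_real (k\<^sup>2 / 2) * of_real t))
          = indicator {0<..} k *\<^sub>R (A * (amplitude a lam b (of_real k) / (of_real k - z)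
              * exp (- \<i> * of_real (k\<^sup>2 / 2) * of_real t)))"
        proof (cases "0 < k")
          case True
          then have "k\<^sup>2 \<noteq> b\<^sup>2 + 2 * lam" using k real_sqrt_unique[of k "b\<^sup>2 + 2 * lam"] by auto
          then have hat: "psi_hat a lam n k = exp (\<i> * of_real k * of_real a) *
              (2 * of_real (b * s) / of_real (sqrt pi)) * amplitude a lam b (of_real k)"
            unfolding s_def b_def using cosb True assms(1) by (intro psi_hat_eq) (auto simp: b_def)
          have e: "eta a lam n k = exp (- \<i> * of_real k * of_real a) * (res / (of_real k - z))"
            by (simp add: eta_def res_def z_def)
          have "exp (\<i> * of_real k * of_real a) * exp (- \<i> * of_real k * of_real a) = (1::complex)"
            by (simp flip: exp_add)
          then have "psi_hat a lam n k * eta a lam n k = A * (amplitude a lam b (of_real k) / (of_real k - z))"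
            unfolding hat e A_def by (simp add: field_simps)
          then show ?thesis by (simp add: mult.assoc)
        qed auto
      qed auto
      then show ?thesis by (simp only: set_integral_mult_right)
    qed

    have r_le: "norm (r t) \<le> C * lam powr (-2) * t powr (-1/2)" if "0 < t" for t
    proof -
      have "norm ((LINT k:{0<..}|lborel. amplitude a lam b (of_real k) / (of_real k - z)
          * exp (- \<i> * of_real (k\<^sup>2 / 2) * of_real t))
          + 2 * pi * \<i> * amplitude a lam b z * exp (- \<i> * (z\<^sup>2 / 2) * of_real t)) \<le> 4 / (lam * L) * pi / sqrt t"
      \<comment> \<open>Beyond this radius \<open>norm w ^ 2\<close> is at least twice
        \<open>b^2 + 2 lam\<close>, so the denominator is at least \<open>norm w ^ 2 / 2\<close> and
        the amplitude at most \<open>4 / norm w ^ 2\<close>.\<close>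
      proof (rule rotate_to_diagonal[where B = 4 and ?R0.0 = "sqrt (2 * (b\<^sup>2 + 2 * lam))"])
        show "continuous_on wedge (amplitude a lam b)"
          by (rule continuous_on_amplitude[OF assms(1) lam0 b])
        show "amplitude a lam b field_differentiable at w" if "0 < - Im w" "- Im w < Re w" for w
          by (rule amplitude_field_differentiable[OF assms(1) lam0 b that])
      next
        fix w assume w: "w \<in> wedge" "sqrt (2 * (b\<^sup>2 + 2 * lam)) \<le> norm w"
        define q where "q = b\<^sup>2 + 2 * lam"
        have q: "0 < q" using lam0 by (simp add: q_def add_nonneg_pos)
        have "(sqrt (2 * q))\<^sup>2 \<le> (norm w)\<^sup>2" using w q by (intro power_mono) (auto simp: q_def)
        then have *: "2 * q \<le> (norm w)\<^sup>2" using q by simp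
        have diff: "(norm w)\<^sup>2 / 2 \<le> norm (of_real q - w\<^sup>2)"
          using norm_triangle_ineq2[of "w\<^sup>2" "of_real q"] * q by (simp add: norm_power norm_minus_commute)
        have "w\<^sup>2 \<noteq> of_real q" using diff * q by auto
        then have "norm (amplitude a lam b w) \<le> 2 / norm (of_real q - w\<^sup>2)"
          unfolding q_def by (rule norm_amplitude_le[OF assms(1) lam0 cosb w(1)])
        also have "\<dots> \<le> 2 / ((norm w)\<^sup>2 / 2)"
          using diff * q by (intro divide_left_mono mult_pos_pos) auto
        finally show "norm (amplitude a lam b w) \<le> 4 / (norm w)\<^sup>2" by simp
      next
        fix y :: real assume y: "0 \<le> y"
        define w where "w = Complex y (- y)"
        have w: "w \<in> wedge" using y by (simp add: w_def wedge_def)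
        \<comment> \<open>On the diagonal \<open>w^2\<close> is purely imaginary and cannot cancel
          \<open>b^2 + 2 lam\<close>.\<close>
        have "Re (of_real (b\<^sup>2 + 2 * lam) - w\<^sup>2) = b\<^sup>2 + 2 * lam"
          by (simp add: w_def Re_power2)
        then have low: "2 * lam \<le> norm (of_real (b\<^sup>2 + 2 * lam) - w\<^sup>2)"
          using complex_Re_le_cmod[of "of_real (b\<^sup>2 + 2 * lam) - w\<^sup>2"] zero_le_power2[of b] by linarith
        then have "w\<^sup>2 \<noteq> of_real (b\<^sup>2 + 2 * lam)" using lam0 by auto
        then have "norm (amplitude a lam b w) \<le> 2 / norm (of_real (b\<^sup>2 + 2 * lam) - w\<^sup>2)"
          by (rule norm_amplitude_le[OF assms(1) lam0 cosb w])
        also have "\<dots> \<le> 2 / (2 * lam)" using low lam0 by (intro divide_left_mono mult_pos_pos) auto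
        finally have amp: "norm (amplitude a lam b w) \<le> 1 / lam" by simp
        \<comment> \<open>Real and imaginary part of \<open>w\<close> sum to 0, so those of
          \<open>w - z\<close> sum to at most \<open>- L / 2\<close>, and one of them has modulus at
          least \<open>L / 4\<close>.\<close>
        have "L / 4 \<le> norm (w - z)"
          using abs_Re_le_cmod[of "w - z"] abs_Im_le_cmod[of "w - z"] facts(3) by (simp add: w_def)
        then have "norm (amplitude a lam b w) / norm (w - z) \<le> (1 / lam) / (L / 4)"
          using amp L lam0 by (intro frac_le) auto
        then show "norm (amplitude a lam b (Complex y (- y)) / (Complex y (- y) - z)) \<le> 4 / (lam * L)"
          by (simp add: norm_divide flip: w_def)
      qed (use facts that in auto)
      then have "norm A * norm ((LINT k:{0<..}|lborel. amplitude a lam b (of_real k) / (of_real k - z)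
          * exp (- \<i> * of_real (k\<^sup>2 / 2) * of_real t))
          + 2 * pi * \<i> * amplitude a lam b z * exp (- \<i> * (z\<^sup>2 / 2) * of_real t))
          \<le> 8 * b\<^sup>2 / (a * L * pi) * (4 / (lam * L) * pi / sqrt t)"
        using A_le by (intro mult_mono) (auto intro: order_trans[OF norm_ge_zero])
      moreover have "r t = A * ((LINT k:{0<..}|lborel. amplitude a lam b (of_real k) / (of_real k - z)
          * exp (- \<i> * of_real (k\<^sup>2 / 2) * of_real t))
          + 2 * pi * \<i> * amplitude a lam b z * exp (- \<i> * (z\<^sup>2 / 2) * of_real t))"
        unfolding r_def J_eq c_def by (simp add: algebra_simps)
      ultimately have "norm (r t) \<le> 8 * b\<^sup>2 / (a * L * pi) * (4 / (lam * L) * pi / sqrt t)"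
        by (simp only: norm_mult)
      \<comment> \<open>One \<open>1 / L\<close> comes from \<open>A\<close>, one from the distance
        to \<open>z\<close>, and \<open>1 / lam\<close> from the amplitude;
        \<open>L * L = 2 lam\<close> gives the second power of \<open>lam\<close>.\<close>
      also have "\<dots> = 32 * b\<^sup>2 / (a * lam * (L * L) * sqrt t)" by simp
      also have "\<dots> = 16 * b\<^sup>2 / a * (1 / (lam\<^sup>2 * sqrt t))"
        unfolding L(2) by (simp add: power2_eq_square)
      also have "\<dots> \<le> C * (1 / (lam\<^sup>2 * sqrt t))"
        using C that by (intro mult_right_mono) auto
      also have "1 / (lam\<^sup>2 * sqrt t) = lam powr (-2) * t powr (-1/2)"
      proof -
        have 1: "lam powr (-2) = inverse (lam\<^sup>2)"
          using lam0 powr_minus[of lam 2] powr_realpow[of lam 2] by simp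
        have 2: "t powr (-1/2) = inverse (sqrt t)"
          using that powr_minus[of t "1/2"] powr_half_sqrt[of t] by simp
        show ?thesis unfolding 1 2 by (simp add: divide_simps)
      qed
      finally show ?thesis by (simp add: mult.assoc)
    qed
    show "\<exists>(c :: complex) (r :: real \<Rightarrow> complex).
         c \<noteq> 0 \<and>
         (\<forall>t>0. \<forall>x.
            Psi a lam n x t
            = c * chi a x * gamow a lam n x * exp (- \<i> * ((zres a lam n)\<^sup>2 / 2) * of_real t)
              + chi a x * gamow a lam n x * r t) \<and>
         norm c \<le> C \<and>
         (\<forall>t>0. norm (r t) \<le> C * lam powr (-2) * t powr (-1/2))"
    proof (intro exI[of _ c] exI[of _ r] conjI allI impI \<open>c \<noteq> 0\<close> c_le r_le)
      fix t x :: real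
      show "Psi a lam n x t
            = c * chi a x * gamow a lam n x * exp (- \<i> * ((zres a lam n)\<^sup>2 / 2) * of_real t)
              + chi a x * gamow a lam n x * r t"
        unfolding Psi_def J_def[symmetric] r_def z_def[symmetric] by algebra
    qed
  qed
qed

end
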